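(* Let $\alpha\in(1/2,1)$ and $C$ be constants and let $G\sim\mathcal G(n,\alpha,C)$ be a threshold hyperbolic random graph. Then $G$ can be coloured by a deterministic distributed algorithm in the LOCAL model in a constant number of rounds and with $(1+o(1))\cdot\chi$ colours w.e.h.p., where $\chi$ is the chromatic number of $G$.
   Context: Hyperbolic random graph $\mathcal G(n,\alpha,C)$: for constants $\alpha\in(1/2,1)$ and $C$, set $R=2\log n+C$ (natural logarithm). Let $\mathcal D_R$ be the disk of radius $R$ around the origin in the hyperbolic plane of curvature $-1$, with points in polar coordinates $(r,\varphi)$. The hyperbolic distance satisfies $\cosh d(x,y)=\cosh r(x)\cosh r(y)-\sinh r(x)\sinh r(y)\cos(\varphi(x)-\varphi(y))$. The vertex set $V$ is a Poisson point process on $\mathcal D_R$ with intensity $n\rho(r)$ with respect to $dr\,d\varphi$, where $\rho(r)=\frac{\alpha\sinh(\alpha r)}{2\pi(\cosh(\alpha R)-1)}$. Vertices are adjacent iff their hyperbolic distance is at most $R$ (threshold model). Asymptotics are as $n\to\infty$. An event holds w.e.h.p. if it has probability $1-n^{-\omega(1)}$; here the probability is over the random graph. LOCAL model: each vertex is a processor with a unique ID (from a polynomial-size ID space). Vertices communicate with their neighbours in synchronous rounds with messages of unbounded size. At the end, each vertex outputs its own colour, and adjacent vertices must output distinct colours. *)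

theory Defs
  imports "HOL-Probability.Probability"
begin

section \<open>Hyperbolic random graphs\<close>

(* Poisson point process with finite intensity measure mu, as a random finite set of points.  This
   is adequate for a diffuse mu, for which the process almost surely has no multiple points.
   poisson_pmf is not used because it is specified for strictly positive rates only. *)
definition poisson_point_process :: "'w measure \<Rightarrow> 'a measure \<Rightarrow> ('w \<Rightarrow> 'a set) \<Rightarrow> bool" where
  "poisson_point_process P \<mu> X \<longleftrightarrow>
     prob_space P \<and> finite_measure \<mu> \<and>
     (\<forall>\<omega>\<in>space P. finite (X \<omega>) \<and> X \<omega> \<subseteq> space \<mu>) \<and>
     (\<forall>B\<in>sets \<mu>.
        (\<lambda>\<omega>. card (X \<omega> \<inter> B)) \<in> measurable P (count_space UNIV) \<and>
        (\<forall>k. measure P {\<omega>\<in>space P. card (X \<omega> \<inter> B) = k}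
               = exp (- measure \<mu> B) * measure \<mu> B ^ k / fact k)) \<and>
     (\<forall>(m::nat) B. (\<forall>i<m. B i \<in> sets \<mu>) \<and> disjoint_family_on B {..<m} \<longrightarrow>
        prob_space.indep_vars P (\<lambda>_. count_space UNIV) (\<lambda>i \<omega>. card (X \<omega> \<inter> B i)) {..<m})"

definition hrg_radius :: "nat \<Rightarrow> real \<Rightarrow> real" where
  "hrg_radius n C = 2 * ln (real n) + C"

(* A point of the hyperbolic plane is given by its polar coordinates (r, phi). *)
definition hyp_disk :: "real \<Rightarrow> (real \<times> real) set" where
  "hyp_disk R = {0..R} \<times> {0..<2 * pi}"

definition hyp_dist :: "real \<times> real \<Rightarrow> real \<times> real \<Rightarrow> real" where
  "hyp_dist x y =
     arcosh (cosh (fst x) * cosh (fst y) - sinh (fst x) * sinh (fst y) * cos (snd x - snd y))"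

definition hrg_density :: "real \<Rightarrow> real \<Rightarrow> real \<Rightarrow> real" where
  "hrg_density \<alpha> R r = \<alpha> * sinh (\<alpha> * r) / (2 * pi * (cosh (\<alpha> * R) - 1))"

definition hrg_intensity :: "nat \<Rightarrow> real \<Rightarrow> real \<Rightarrow> (real \<times> real) measure" where
  "hrg_intensity n \<alpha> C =
     density (restrict_space lborel (hyp_disk (hrg_radius n C)))
       (\<lambda>x. ennreal (real n * hrg_density \<alpha> (hrg_radius n C) (fst x)))"

definition hrg_adj :: "nat \<Rightarrow> real \<Rightarrow> real \<times> real \<Rightarrow> real \<times> real \<Rightarrow> bool" where
  "hrg_adj n C x y \<longleftrightarrow> x \<noteq> y \<and> hyp_dist x y \<le> hrg_radius n C"

(* The events E n hold with probability 1 - n^(-omega(1)).  E n need not be known to be measurable: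
   it suffices that it contains a measurable event of that probability. *)
definition wehp :: "(nat \<Rightarrow> 'w measure) \<Rightarrow> (nat \<Rightarrow> 'w set) \<Rightarrow> bool" where
  "wehp P E \<longleftrightarrow>
     (\<exists>f :: nat \<Rightarrow> real. filterlim f at_top sequentially \<and>
       (\<forall>\<^sub>F n in sequentially. \<exists>A\<in>sets (P n). A \<subseteq> E n \<and>
          measure (P n) A \<ge> 1 - real n powr (- f n)))"

section \<open>Colourings\<close>

(* A graph is a vertex set V together with an adjacency relation E, of which only the restriction
   to V matters. *)
definition proper_colouring :: "'v set \<Rightarrow> ('v \<Rightarrow> 'v \<Rightarrow> bool) \<Rightarrow> nat \<Rightarrow> ('v \<Rightarrow> nat) \<Rightarrow> bool" where
  "proper_colouring V E k c \<longleftrightarrow>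
     (\<forall>v\<in>V. c v < k) \<and> (\<forall>u\<in>V. \<forall>v\<in>V. E u v \<longrightarrow> c u \<noteq> c v)"

definition chromatic_number :: "'v set \<Rightarrow> ('v \<Rightarrow> 'v \<Rightarrow> bool) \<Rightarrow> nat" where
  "chromatic_number V E = (LEAST k. \<exists>c. proper_colouring V E k c)"

section \<open>The LOCAL model\<close>

definition nbrs :: "'v set \<Rightarrow> ('v \<Rightarrow> 'v \<Rightarrow> bool) \<Rightarrow> 'v \<Rightarrow> 'v set" where
  "nbrs V E v = {u\<in>V. E v u}"

(* States and messages are bit strings of unbounded length. *)
type_synonym bits = "bool list"

(* All vertices run the same algorithm; there is no restriction on local computation.
     start:   own ID and own degree to the initial state
     send:    current state and port to the message sent through that port
     receive: current state and received messages, listed by port, to the next state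
     result:  final state to the output colour *)
record local_algorithm =
  start :: "nat \<Rightarrow> nat \<Rightarrow> bits"
  send :: "bits \<Rightarrow> nat \<Rightarrow> bits"
  receive :: "bits \<Rightarrow> bits list \<Rightarrow> bits"
  result :: "bits \<Rightarrow> nat"

definition valid_ids :: "nat \<Rightarrow> 'v set \<Rightarrow> ('v \<Rightarrow> nat) \<Rightarrow> bool" where
  "valid_ids N V ident \<longleftrightarrow> inj_on ident V \<and> ident ` V \<subseteq> {..<N}"

(* port v u is the number under which v addresses its neighbour u. *)
definition port_numbering :: "'v set \<Rightarrow> ('v \<Rightarrow> 'v \<Rightarrow> bool) \<Rightarrow> ('v \<Rightarrow> 'v \<Rightarrow> nat) \<Rightarrow> bool" where
  "port_numbering V E port \<longleftrightarrow>
     (\<forall>v\<in>V. bij_betw (port v) (nbrs V E v) {..<card (nbrs V E v)})"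

primrec local_state ::
  "local_algorithm \<Rightarrow> 'v set \<Rightarrow> ('v \<Rightarrow> 'v \<Rightarrow> bool) \<Rightarrow> ('v \<Rightarrow> nat) \<Rightarrow> ('v \<Rightarrow> 'v \<Rightarrow> nat)
     \<Rightarrow> nat \<Rightarrow> 'v \<Rightarrow> bits" where
  "local_state A V E ident port 0 =
     (\<lambda>v. start A (ident v) (card (nbrs V E v)))"
| "local_state A V E ident port (Suc t) =
     (\<lambda>v. receive A (local_state A V E ident port t v)
        (map (\<lambda>i. let u = inv_into (nbrs V E v) (port v) i
                  in send A (local_state A V E ident port t u) (port u v))
             [0..<card (nbrs V E v)]))"

definition local_output ::
  "local_algorithm \<Rightarrow> nat \<Rightarrow> 'v set \<Rightarrow> ('v \<Rightarrow> 'v \<Rightarrow> bool) \<Rightarrow> ('v \<Rightarrow> nat) \<Rightarrow> ('v \<Rightarrow> 'v \<Rightarrow> nat)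
     \<Rightarrow> 'v \<Rightarrow> nat" where
  "local_output A T V E ident port v = result A (local_state A V E ident port T v)"

(* For all IDs below N and all port numberings, T rounds of A colour the graph properly with at most
   q times as many colours as its chromatic number. *)
definition locally_colours ::
  "local_algorithm \<Rightarrow> nat \<Rightarrow> nat \<Rightarrow> real \<Rightarrow> 'v set \<Rightarrow> ('v \<Rightarrow> 'v \<Rightarrow> bool) \<Rightarrow> bool" where
  "locally_colours A T N q V E \<longleftrightarrow>
     (\<forall>ident port. valid_ids N V ident \<and> port_numbering V E port \<longrightarrow>
        (\<exists>k. real k \<le> q * real (chromatic_number V E) \<and>
             proper_colouring V E k (local_output A T V E ident port)))"

end

(* The algorithm splits the vertices by degree, at a threshold D which is a small power of n.

   Vertices of degree at least D lie, w.e.h.p., at radius at most (1 - delta) R.  Such a vertex has a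
   neighbour whose distance from the boundary is larger by the factor 1 / alpha, so after a constant
   number of steps it reaches the core, the clique of all vertices of radius at most R / 2.  Hence
   all high-degree vertices are within constant distance of each other; they gather the graph
   induced on them and all compute the same optimal colouring of it.

   The remaining vertices induce a graph of maximum degree below D.  One round of colour reduction,
   in the style of Linial, takes their IDs to a fresh palette whose size is a small power of n, which is negligible
   because the core forces the chromatic number to be at least n^{Omega(1)}.

   All geometric facts reduce to counting points in boxes {0..rho} x arc, of which there are
   polynomially many, so that union bounds over Poisson tails suffice. *)
theory Submission
  imports Defs "HOL-Real_Asymp.Real_Asymp"
begin

text \<open>A vertex sees degrees, not radii, so only one implication is needed: a vertex near the
  boundary has small degree. Vertices below the threshold may lie anywhere, and edges between the
  two classes cause no conflict because the two palettes are disjoint. The threshold is under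
  tension. The fresh palette is an additive loss of \<open>positions\<close>^3 colours with
  \<open>positions\<close> at least \<open>a * threshold\<close>, so the threshold must stay below a
  small power of the core size. A low threshold, however, lets high-degree vertices lie close to the
  boundary. This is affordable because a start at depth \<delta> R with constant \<delta> needs a
  number of hops that depends on \<alpha> alone. One round of reduction is enough because there are
  only n^c IDs: code words of length m over m^2 symbols that pairwise agree in fewer than a constant
  number \<open>a\<close> of positions exist as soon as n^c < m^a. The exponent c thus enters
  through \<open>a\<close>, not through the number of rounds. Every comparison has a polynomial
  margin, so exponential moments with base 2 or 1 / 2 bound all Poisson tails.\<close>

section \<open>Colour reduction and the LOCAL algorithm\<close>

text \<open>Greedy choice of code words, as in the Gilbert-Varshamov bound; this replaces the polynomials
  over a prime field in Linial's colour reduction and needs no estimate on primes.\<close>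

lemma separating_code:
  fixes N m q a :: nat
  assumes "N * m ^ a < q ^ a" "a \<le> m"
  shows "\<exists>code :: nat \<Rightarrow> nat \<Rightarrow> nat. (\<forall>i<N. \<forall>p<m. code i p < q) \<and>
    (\<forall>i<N. \<forall>j<N. i \<noteq> j \<longrightarrow> card {p. p < m \<and> code i p = code j p} < a)"
  using assms(1)
proof (induction N)
  case 0
  then show ?case by simp
next
  case (Suc N)
  then obtain code :: "nat \<Rightarrow> nat \<Rightarrow> nat" where c1: "\<forall>i<N. \<forall>p<m. code i p < q" and
    c2: "\<forall>i<N. \<forall>j<N. i \<noteq> j \<longrightarrow> card {p. p < m \<and> code i p = code j p} < a"
    by auto
  define W where "W = {..<m} \<rightarrow>\<^sub>E {..<q}"
  define S where "S = {A. A \<subseteq> {..<m} \<and> card A = a}"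
  \<comment> \<open>A word outside every \<open>F i A\<close> can be added to the code. A word in
    \<open>F i A\<close> is determined by its values off \<open>A\<close>, which bounds the number
    of bad words.\<close>
  define F where "F = (\<lambda>i A. {w\<in>W. \<forall>p\<in>A. w p = code i p})"
  have finW: "finite W" and cardW: "card W = q ^ m"
    by (auto simp: W_def finite_PiE card_PiE)
  have finS: "finite S" and cardS: "card S = m choose a"
    using n_subsets[of "{..<m}" a] by (auto simp: S_def)
  have F: "card (F i A) \<le> q ^ (m - a)" if "A \<in> S" for i A
  proof -
    have "inj_on (\<lambda>w. restrict w ({..<m} - A)) (F i A)"
    proof (rule inj_onI)
      fix w w' assume w: "w \<in> F i A" "w' \<in> F i A"
        and eq: "restrict w ({..<m} - A) = restrict w' ({..<m} - A)"
      have "w p = w' p" if "p < m" for p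
        using w fun_cong[OF eq, of p] that by (cases "p \<in> A") (auto simp: F_def restrict_def)
      then show "w = w'"
        using w by (intro PiE_ext[of w "{..<m}" "\<lambda>_. {..<q}" w']) (auto simp: F_def W_def)
    qed
    moreover have "(\<lambda>w. restrict w ({..<m} - A)) ` F i A \<subseteq> ({..<m} - A) \<rightarrow>\<^sub>E {..<q}"
      by (auto simp: F_def W_def)
    moreover have "card (({..<m} - A) \<rightarrow>\<^sub>E {..<q}) = q ^ (m - a)"
      using that by (subst card_PiE) (auto simp: S_def card_Diff_subset finite_subset)
    ultimately show ?thesis
      by (metis card_inj_on_le finite_Diff finite_PiE finite_lessThan)
  qed
  have "card (\<Union>i<N. \<Union>A\<in>S. F i A) \<le> (\<Sum>i<N. \<Sum>A\<in>S. card (F i A))"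
    using finS by (intro order.trans[OF card_UN_le] sum_mono card_UN_le) auto
  also have "\<dots> \<le> (\<Sum>i<N. \<Sum>A\<in>S. q ^ (m - a))"
    by (intro sum_mono F)
  also have "\<dots> = N * (m choose a) * q ^ (m - a)"
    by (simp add: cardS)
  also have "\<dots> \<le> N * m ^ a * q ^ (m - a)"
    using binomial_le_pow[OF assms(2)] by simp
  also have "\<dots> < q ^ a * q ^ (m - a)"
  proof -
    have "q \<noteq> 0" using Suc.prems by (cases "q = 0"; cases a) auto
    then have "0 < q ^ (m - a)" by simp
    then show ?thesis using Suc.prems by simp
  qed
  also have "\<dots> = card W"
    using assms(2) by (simp add: cardW flip: power_add)
  finally have "\<not> W \<subseteq> (\<Union>i<N. \<Union>A\<in>S. F i A)"
    using card_mono[of "\<Union>i<N. \<Union>A\<in>S. F i A" W] finW finS by (auto simp: F_def)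
  then obtain w where w: "w \<in> W" "\<And>i A. i < N \<Longrightarrow> A \<in> S \<Longrightarrow> w \<notin> F i A"
    by blast
  have agree: "card {p. p < m \<and> w p = code i p} < a" if "i < N" for i
  proof (rule ccontr)
    assume "\<not> ?thesis"
    then obtain A where "A \<subseteq> {p. p < m \<and> w p = code i p}" "card A = a"
      using obtain_subset_with_card_n[of a "{p. p < m \<and> w p = code i p}"] by auto
    then show False using w(2)[OF that, of A] w(1) by (auto simp: S_def F_def)
  qed
  have agree': "card {p. p < m \<and> code i p = w p} < a" if "i < N" for i
    using agree[OF that] by (simp add: eq_commute)
  show ?case
  proof (intro exI[of _ "code(N := w)"] conjI)
    show "\<forall>i<Suc N. \<forall>p<m. (code(N := w)) i p < q"
      using c1 w(1) by (auto simp: less_Suc_eq W_def)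
    show "\<forall>i<Suc N. \<forall>j<Suc N. i \<noteq> j \<longrightarrow>
        card {p. p < m \<and> (code(N := w)) i p = (code(N := w)) j p} < a"
      using c2 agree agree' by (auto simp: less_Suc_eq)
  qed
qed

section \<open>Chromatic numbers: existence of optimal colourings, cliques, subgraphs\<close>

lemma chromatic_number_le: "proper_colouring V E k c \<Longrightarrow> chromatic_number V E \<le> k"
  unfolding chromatic_number_def by (rule Least_le) auto

lemma proper_colouring_chromatic_number:
  assumes "finite V" "\<And>v. v \<in> V \<Longrightarrow> \<not> E v v"
  obtains c where "proper_colouring V E (chromatic_number V E) c"
proof -
  obtain f :: "'a \<Rightarrow> nat" where f: "inj_on f V" "f ` V = {..<card V}"
    using ex_bij_betw_finite_nat[OF assms(1)] by (auto simp: bij_betw_def atLeast0LessThan)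
  have "proper_colouring V E (card V) f"
    using f assms(2) by (auto simp: proper_colouring_def inj_on_def)
  then have "\<exists>c. proper_colouring V E (chromatic_number V E) c"
    unfolding chromatic_number_def by (intro LeastI_ex[of "\<lambda>k. \<exists>c. proper_colouring V E k c"]) auto
  then show ?thesis using that by auto
qed

lemma clique_le_chromatic_number:
  assumes "finite V" "\<And>v. v \<in> V \<Longrightarrow> \<not> E v v" "Q \<subseteq> V"
    "\<And>u v. u \<in> Q \<Longrightarrow> v \<in> Q \<Longrightarrow> u \<noteq> v \<Longrightarrow> E u v"
  shows "card Q \<le> chromatic_number V E"
proof -
  obtain c where c: "proper_colouring V E (chromatic_number V E) c"
    using proper_colouring_chromatic_number[of V E] assms(1,2) by blast
  have "inj_on c Q" "c ` Q \<subseteq> {..<chromatic_number V E}"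
    using c assms(3,4) by (fastforce simp: proper_colouring_def inj_on_def)+
  then show ?thesis
    using card_inj_on_le[of c Q "{..<chromatic_number V E}"] by auto
qed

text \<open>An optimal colouring of \<open>V\<close> is read through the inverse of
  \<open>f\<close>. This compares the graph that high-degree vertices reconstruct on IDs with the
  graph on points.\<close>

lemma chromatic_number_transfer_le:
  assumes "finite V" "\<And>v. v \<in> V \<Longrightarrow> \<not> E v v" "inj_on f V" "W \<subseteq> f ` V"
    "\<And>u v. u \<in> V \<Longrightarrow> v \<in> V \<Longrightarrow> E' (f u) (f v) \<Longrightarrow> E u v"
  shows "chromatic_number W E' \<le> chromatic_number V E"
proof -
  obtain c where c: "proper_colouring V E (chromatic_number V E) c"
    using proper_colouring_chromatic_number[of V E] assms(1,2) by blast
  have "proper_colouring W E' (chromatic_number V E) (\<lambda>w. c (inv_into V f w))"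
    unfolding proper_colouring_def
  proof (intro conjI ballI impI)
    fix w assume "w \<in> W"
    then show "c (inv_into V f w) < chromatic_number V E"
      using c assms(4) by (auto simp: proper_colouring_def inv_into_into subset_iff)
  next
    fix w w' assume w: "w \<in> W" "w' \<in> W" "E' w w'"
    then obtain u v where "u \<in> V" "v \<in> V" "w = f u" "w' = f v"
      using assms(4) by blast
    then show "c (inv_into V f w) \<noteq> c (inv_into V f w')"
      using c assms(3,5) w by (auto simp: proper_colouring_def)
  qed
  then show ?thesis by (rule chromatic_number_le)
qed

text \<open>Unfolding at the first step matches message passing: after one more round
  \<open>v\<close> knows what it and its neighbours knew before.\<close>

primrec hops :: "'v set \<Rightarrow> ('v \<Rightarrow> 'v \<Rightarrow> bool) \<Rightarrow> nat \<Rightarrow> 'v \<Rightarrow> 'v set" where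
  "hops V E 0 v = {v}"
| "hops V E (Suc t) v = hops V E t v \<union> (\<Union>u\<in>nbrs V E v. hops V E t u)"

lemma self_in_hops: "v \<in> hops V E t v"
  by (induction t) auto

lemma hops_subset: "v \<in> V \<Longrightarrow> hops V E t v \<subseteq> V"
proof (induction t arbitrary: v)
  case (Suc t)
  have "u \<in> V" if "u \<in> nbrs V E v" for u using that by (simp add: nbrs_def)
  then show ?case using Suc by fastforce
qed auto

lemma finite_nbrs: "finite V \<Longrightarrow> finite (nbrs V E v)"
  by (simp add: nbrs_def)

lemma hops_mono: "s \<le> t \<Longrightarrow> hops V E s v \<subseteq> hops V E t v"
  by (rule lift_Suc_mono_le[of "\<lambda>t. hops V E t v"]) auto

lemma hops_trans: "u \<in> hops V E s v \<Longrightarrow> w \<in> hops V E t u \<Longrightarrow> w \<in> hops V E (s + t) v"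
proof (induction s arbitrary: v)
  case (Suc s)
  show ?case
  proof (cases "u \<in> hops V E s v")
    case True
    then show ?thesis using Suc by auto
  next
    case False
    then obtain x where "x \<in> nbrs V E v" "u \<in> hops V E s x" using Suc by auto
    then show ?thesis using Suc by auto
  qed
qed auto

lemma hops_1: "u \<in> nbrs V E v \<Longrightarrow> u \<in> hops V E 1 v"
  by auto

lemma hops_sym:
  assumes "\<And>x y. E x y \<Longrightarrow> E y x"
  shows "v \<in> V \<Longrightarrow> u \<in> hops V E t v \<Longrightarrow> v \<in> hops V E t u"
proof (induction t arbitrary: v)
  case (Suc t)
  show ?case
  proof (cases "u \<in> hops V E t v")
    case True
    then show ?thesis using Suc by auto
  next
    case False
    then obtain x where x: "x \<in> nbrs V E v" "u \<in> hops V E t x" using Suc by auto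
    then have "x \<in> hops V E t u" using Suc by (auto simp: nbrs_def)
    moreover have "v \<in> hops V E 1 x"
      using x Suc.prems assms by (intro hops_1) (auto simp: nbrs_def)
    ultimately show ?thesis using hops_trans[of x V E t u v 1] by simp
  qed
qed auto

section \<open>The algorithm: gathering edges and choosing a colour\<close>

definition encode :: "'a::countable \<Rightarrow> bits" where
  "encode x = replicate (to_nat x) True"

definition decode :: "bits \<Rightarrow> 'a::countable" where
  "decode b = from_nat (length b)"

text \<open>Messages may be arbitrarily long, so a unary code of a countable type is good
  enough.\<close>

lemma decode_encode [simp]: "decode (encode x) = x"
  by (simp add: encode_def decode_def)

text \<open>The edge sets are directed: pairs starting at \<open>j\<close> are recorded all together
  or not at all. The count is thus the true degree of \<open>j\<close> or zero, never a partial
  degree.\<close>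

definition high_ids :: "nat \<Rightarrow> (nat \<times> nat) set \<Rightarrow> nat set" where
  "high_ids D S = {j. D \<le> card (S `` {j})}"

definition high_adj :: "nat \<Rightarrow> (nat \<times> nat) set \<Rightarrow> nat \<Rightarrow> nat \<Rightarrow> bool" where
  "high_adj D S i j \<longleftrightarrow> (i, j) \<in> S \<and> i \<in> high_ids D S \<and> j \<in> high_ids D S"

text \<open>A fixed choice that depends on the graph alone: vertices that know the same graph obtain
  the same colouring.\<close>

definition optimal_colouring :: "'v set \<Rightarrow> ('v \<Rightarrow> 'v \<Rightarrow> bool) \<Rightarrow> 'v \<Rightarrow> nat" where
  "optimal_colouring V E = (SOME c. proper_colouring V E (chromatic_number V E) c)"

definition free_position :: "nat \<Rightarrow> nat \<Rightarrow> (nat \<Rightarrow> nat \<Rightarrow> nat) \<Rightarrow> nat \<Rightarrow> (nat \<times> nat) set \<Rightarrow> nat" where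
  "free_position D m code i S =
     (LEAST p. p < m \<and> (\<forall>j \<in> S `` {i} - high_ids D S. code i p \<noteq> code j p))"

text \<open>A low-degree colour encodes a pair of a position below \<open>m\<close> and a symbol
  below \<open>q\<close>. High-degree colours start at \<open>m * q\<close>, above all of
  these.\<close>

definition output_colour ::
  "nat \<Rightarrow> nat \<Rightarrow> nat \<Rightarrow> (nat \<Rightarrow> nat \<Rightarrow> nat) \<Rightarrow> nat \<Rightarrow> (nat \<times> nat) set \<Rightarrow> nat" where
  "output_colour D m q code i S =
     (if i \<in> high_ids D S then m * q + optimal_colouring (high_ids D S) (high_adj D S) i
      else free_position D m code i S * q + code i (free_position D m code i S))"

definition gather :: "nat \<times> (nat \<times> nat) list \<Rightarrow> (nat \<times> (nat \<times> nat) list) list \<Rightarrow> nat \<times> (nat \<times> nat) list" where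
  "gather s ms = (fst s, snd s @ concat (map snd ms) @ map (\<lambda>s'. (fst s, fst s')) ms)"

definition colouring_algorithm ::
  "nat \<Rightarrow> nat \<Rightarrow> nat \<Rightarrow> (nat \<Rightarrow> nat \<Rightarrow> nat) \<Rightarrow> local_algorithm" where
  "colouring_algorithm D m q code = \<lparr>
     start = \<lambda>i d. encode (i, [] :: (nat \<times> nat) list),
     send = \<lambda>s _. s,
     receive = \<lambda>s ms. encode (gather (decode s) (map decode ms)),
     result = \<lambda>s. case decode s of (i, S) \<Rightarrow> output_colour D m q code i (set S)\<rparr>"

definition seen_edges ::
  "'v set \<Rightarrow> ('v \<Rightarrow> 'v \<Rightarrow> bool) \<Rightarrow> ('v \<Rightarrow> nat) \<Rightarrow> nat \<Rightarrow> 'v \<Rightarrow> (nat \<times> nat) set" where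
  "seen_edges V E ident t v = (\<Union>x\<in>hops V E t v. {ident x} \<times> ident ` nbrs V E x)"

text \<open>The first round delivers only IDs, hence \<open>Suc t\<close> rounds for the edges at
  all vertices within \<open>t\<close> hops. Order and repetitions in the list depend on the ports,
  so only its set is determined.\<close>

lemma local_state_colouring_algorithm:
  assumes "port_numbering V E port" "v \<in> V"
  shows "\<exists>S. local_state (colouring_algorithm D m q code) V E ident port (Suc t) v
             = encode (ident v, S) \<and> set S = seen_edges V E ident t v"
  using assms(2)
proof (induction t arbitrary: v)
  case 0
  let ?A = "colouring_algorithm D m q code"
  define us where "us = map (inv_into (nbrs V E v) (port v)) [0..<card (nbrs V E v)]"
  have "inv_into (nbrs V E v) (port v) ` {0..<card (nbrs V E v)} = nbrs V E v"
    using assms(1) 0 by (metis port_numbering_def bij_betw_def bij_betw_inv_into atLeast0LessThan)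
  then have us: "set us = nbrs V E v" by (simp add: us_def)
  have "local_state ?A V E ident port (Suc 0) v =
      receive ?A (encode (ident v, [] :: (nat \<times> nat) list))
        (map (\<lambda>u. encode (ident u, [] :: (nat \<times> nat) list)) us)"
    by (simp add: us_def colouring_algorithm_def Let_def comp_def)
  also have "\<dots> = encode (ident v, concat (map (\<lambda>u. []) us) @ map (\<lambda>u. (ident v, ident u)) us)"
    by (simp add: colouring_algorithm_def gather_def comp_def)
  finally have eq: "local_state ?A V E ident port (Suc 0) v =
      encode (ident v, concat (map (\<lambda>u. []) us) @ map (\<lambda>u. (ident v, ident u)) us)" .
  have "set (concat (map (\<lambda>u. []) us) @ map (\<lambda>u. (ident v, ident u)) us) =
      seen_edges V E ident 0 v"
    using us by (auto simp: seen_edges_def)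
  then show ?case using eq by blast
next
  case (Suc t)
  let ?A = "colouring_algorithm D m q code"
  let ?l = "\<lambda>t. local_state ?A V E ident port t"
  have inv: "inv_into (nbrs V E v) (port v) ` {0..<card (nbrs V E v)} = nbrs V E v"
    using assms(1) Suc.prems
    by (metis port_numbering_def bij_betw_def bij_betw_inv_into atLeast0LessThan)
  have "\<forall>v\<in>V. \<exists>S. ?l (Suc t) v = encode (ident v, S) \<and> set S = seen_edges V E ident t v"
    using Suc.IH by blast
  then obtain S where S: "\<And>v. v \<in> V \<Longrightarrow> ?l (Suc t) v = encode (ident v, S v)"
      "\<And>v. v \<in> V \<Longrightarrow> set (S v) = seen_edges V E ident t v"
    by (auto dest!: bchoice)
  define us where "us = map (inv_into (nbrs V E v) (port v)) [0..<card (nbrs V E v)]"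
  have us: "set us = nbrs V E v" using inv by (simp add: us_def)
  have "?l (Suc (Suc t)) v = receive ?A (?l (Suc t) v) (map (?l (Suc t)) us)"
    unfolding local_state.simps(2)[where t = "Suc t"]
    by (simp add: us_def colouring_algorithm_def Let_def comp_def)
  also have "map (?l (Suc t)) us = map (\<lambda>u. encode (ident u, S u)) us"
    using us by (intro map_cong refl S) (auto simp: nbrs_def)
  also have "receive ?A (?l (Suc t) v) \<dots> =
     encode (ident v, S v @ concat (map S us) @ map (\<lambda>u. (ident v, ident u)) us)"
    using S(1)[OF Suc.prems] by (simp add: colouring_algorithm_def gather_def comp_def)
  finally have eq: "?l (Suc (Suc t)) v =
     encode (ident v, S v @ concat (map S us) @ map (\<lambda>u. (ident v, ident u)) us)" .
  have "set (S v @ concat (map S us) @ map (\<lambda>u. (ident v, ident u)) us) =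
      set (S v) \<union> (\<Union>u\<in>nbrs V E v. set (S u)) \<union> {ident v} \<times> ident ` nbrs V E v"
    using us by auto
  also have "\<dots> = seen_edges V E ident t v \<union> (\<Union>u\<in>nbrs V E v. seen_edges V E ident t u)
      \<union> {ident v} \<times> ident ` nbrs V E v"
    using S(2) Suc.prems by (auto simp: nbrs_def)
  also have "\<dots> = seen_edges V E ident (Suc t) v"
    using self_in_hops[of v V E t] by (auto simp: seen_edges_def)
  finally show ?case using eq by blast
qed

text \<open>By \<open>near\<close>, all high-degree vertices see the same high-degree graph and
  agree on one optimal colouring of it. At a low-degree vertex, each of fewer than \<open>D\<close>
  neighbours spoils fewer than \<open>a\<close> of the \<open>m\<close> positions, so a free one
  remains.\<close>

lemma proper_colouring_colouring_algorithm:
  assumes V: "finite V" and irrefl: "\<And>v. \<not> E v v" and sym: "\<And>u v. E u v \<Longrightarrow> E v u"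
    and near: "\<And>u v. u \<in> V \<Longrightarrow> v \<in> V \<Longrightarrow> D \<le> card (nbrs V E u) \<Longrightarrow> D \<le> card (nbrs V E v)
        \<Longrightarrow> v \<in> hops V E T u"
    and T: "1 \<le> T" and D: "1 \<le> D" "0 < a" "a * D \<le> m"
    and code: "\<And>i p. i < N \<Longrightarrow> p < m \<Longrightarrow> code i p < q"
      "\<And>i j. i < N \<Longrightarrow> j < N \<Longrightarrow> i \<noteq> j \<Longrightarrow> card {p. p < m \<and> code i p = code j p} < a"
    and ids: "valid_ids N V ident" and port: "port_numbering V E port"
  shows "proper_colouring V E (m * q + chromatic_number V E)
    (local_output (colouring_algorithm D m q code) (Suc T) V E ident port)"
proof -
  define S where "S = seen_edges V E ident T"
  let ?out = "local_output (colouring_algorithm D m q code) (Suc T) V E ident port"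
  have out: "?out v = output_colour D m q code (ident v) (S v)" if v: "v \<in> V" for v
  proof -
    obtain L where L: "local_state (colouring_algorithm D m q code) V E ident port (Suc T) v
             = encode (ident v, L)" "set L = S v"
      using local_state_colouring_algorithm[OF port v] unfolding S_def by blast
    show ?thesis
      unfolding local_output_def L(1) using L(2) by (simp add: colouring_algorithm_def)
  qed
  have inj: "inj_on ident V" and lt: "\<And>v. v \<in> V \<Longrightarrow> ident v < N"
    using ids by (auto simp: valid_ids_def)
  have nV: "nbrs V E v \<subseteq> V" for v by (auto simp: nbrs_def)
  have Sin: "(ident x, ident y) \<in> S v \<longleftrightarrow> x \<in> hops V E T v \<and> y \<in> nbrs V E x"
    if "v \<in> V" "x \<in> V" "y \<in> V" for v x y
  proof
    assume "(ident x, ident y) \<in> S v"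
    then obtain x' y' where xy: "x' \<in> hops V E T v" "y' \<in> nbrs V E x'"
        "ident x = ident x'" "ident y = ident y'"
      unfolding S_def seen_edges_def by blast
    moreover have "x' \<in> V" "y' \<in> V"
      using xy(1,2) hops_subset[OF that(1), of E T] nV[of x'] by auto
    ultimately show "x \<in> hops V E T v \<and> y \<in> nbrs V E x"
      using inj_onD[OF inj] that(2,3) by metis
  qed (auto simp: S_def seen_edges_def)
  have Ssub: "S v \<subseteq> ident ` V \<times> ident ` V" if "v \<in> V" for v
  proof
    fix e assume "e \<in> S v"
    then obtain x y where xy: "x \<in> hops V E T v" "y \<in> nbrs V E x" "e = (ident x, ident y)"
      unfolding S_def seen_edges_def by blast
    then have "x \<in> V" "y \<in> V" using hops_subset[OF that, of E T] nV[of x] by auto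
    then show "e \<in> ident ` V \<times> ident ` V" using xy(3) by simp
  qed
  have Simg: "S v `` {ident x} = (if x \<in> hops V E T v then ident ` nbrs V E x else {})"
    if "v \<in> V" "x \<in> V" for v x
  proof (rule set_eqI)
    fix j
    show "j \<in> S v `` {ident x} \<longleftrightarrow> j \<in> (if x \<in> hops V E T v then ident ` nbrs V E x else {})"
    proof (cases "j \<in> ident ` V")
      case True
      then obtain y where y: "y \<in> V" "j = ident y" by blast
      then show ?thesis
        using Sin[OF that y(1)] inj_on_image_mem_iff[OF inj y(1) nV[of x]] by simp
    next
      case False
      then show ?thesis using Ssub[OF that(1)] image_mono[OF nV[of x], of ident] by auto
    qed
  qed
  have cardS: "card (S v `` {ident x}) = (if x \<in> hops V E T v then card (nbrs V E x) else 0)"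
    if "v \<in> V" "x \<in> V" for v x
    using Simg[OF that] card_image[OF inj_on_subset[OF inj nV[of x]]] by simp
  \<comment> \<open>Beyond \<open>T\<close> hops the recorded degree is 0, which is below the
    threshold because \<open>1 \<le> D\<close>.\<close>
  have high: "ident x \<in> high_ids D (S v) \<longleftrightarrow> x \<in> hops V E T v \<and> D \<le> card (nbrs V E x)"
    if "v \<in> V" "x \<in> V" for v x
    using cardS[OF that] D(1) by (auto simp: high_ids_def)
  have high_sub: "high_ids D (S v) \<subseteq> ident ` V" if "v \<in> V" for v
  proof
    fix j assume "j \<in> high_ids D (S v)"
    then have "S v `` {j} \<noteq> {}" using D(1) by (auto simp: high_ids_def)
    then show "j \<in> ident ` V" using Ssub[OF that] by blast
  qed
  have own: "ident v \<in> high_ids D (S v) \<longleftrightarrow> D \<le> card (nbrs V E v)" if "v \<in> V" for v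
    using high[OF that that] self_in_hops[of v V E T] by auto
  \<comment> \<open>\<open>Hs\<close> and \<open>Ea\<close> do not depend on \<open>v\<close>;
    identifying the reconstructed graph of every high-degree vertex with them shows that the chosen
    colourings coincide.\<close>
  define Hs where "Hs = ident ` {v\<in>V. D \<le> card (nbrs V E v)}"
  define Ea where "Ea = (\<lambda>i j. \<exists>x\<in>V. \<exists>y\<in>V. D \<le> card (nbrs V E x) \<and> D \<le> card (nbrs V E y)
      \<and> E x y \<and> i = ident x \<and> j = ident y)"
  have Hs: "high_ids D (S v) = Hs" if vD: "v \<in> V" "D \<le> card (nbrs V E v)" for v
  proof (intro subset_antisym subsetI)
    fix j assume j: "j \<in> high_ids D (S v)"
    then obtain x where "x \<in> V" "j = ident x" using high_sub[OF vD(1)] by blast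
    then show "j \<in> Hs" using j high[OF vD(1)] by (auto simp: Hs_def)
  next
    fix j assume "j \<in> Hs"
    then obtain x where "x \<in> V" "D \<le> card (nbrs V E x)" "j = ident x"
      by (auto simp: Hs_def)
    then show "j \<in> high_ids D (S v)"
      using high[OF vD(1)] near[OF vD(1) _ vD(2)] by simp
  qed
  have Ea: "high_adj D (S v) = Ea" if v: "v \<in> V" "D \<le> card (nbrs V E v)" for v
  proof (intro ext)
    fix i j
    have "high_adj D (S v) i j \<longleftrightarrow> (i, j) \<in> S v \<and> i \<in> Hs \<and> j \<in> Hs"
      by (simp add: high_adj_def Hs[OF v])
    also have "\<dots> \<longleftrightarrow> Ea i j"
    proof
      assume "(i, j) \<in> S v \<and> i \<in> Hs \<and> j \<in> Hs"
      then obtain x y where xy: "x \<in> V" "D \<le> card (nbrs V E x)" "i = ident x"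
          "y \<in> V" "D \<le> card (nbrs V E y)" "j = ident y" "(ident x, ident y) \<in> S v"
        unfolding Hs_def by blast
      then have "E x y" using Sin[OF v(1) xy(1,4)] by (simp add: nbrs_def)
      then show "Ea i j" unfolding Ea_def using xy by blast
    next
      assume "Ea i j"
      then obtain x y where xy: "x \<in> V" "D \<le> card (nbrs V E x)" "i = ident x"
          "y \<in> V" "D \<le> card (nbrs V E y)" "j = ident y" "E x y"
        unfolding Ea_def by blast
      then have "(ident x, ident y) \<in> S v"
        using Sin[OF v(1) xy(1,4)] near[OF v(1) xy(1) v(2) xy(2)] by (simp add: nbrs_def)
      then show "(i, j) \<in> S v \<and> i \<in> Hs \<and> j \<in> Hs"
        unfolding Hs_def using xy by simp
    qed
    finally show "high_adj D (S v) i j = Ea i j" .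
  qed
  have Ea_irrefl: "\<not> Ea i i" for i
    using inj irrefl by (auto simp: Ea_def inj_on_def)
  have "finite Hs" using V by (simp add: Hs_def)
  then have "\<exists>c. proper_colouring Hs Ea (chromatic_number Hs Ea) c"
    using proper_colouring_chromatic_number[of Hs Ea] Ea_irrefl by blast
  then have opt: "proper_colouring Hs Ea (chromatic_number Hs Ea) (optimal_colouring Hs Ea)"
    unfolding optimal_colouring_def by (rule someI_ex)
  have chi: "chromatic_number Hs Ea \<le> chromatic_number V E"
    by (rule chromatic_number_transfer_le[OF V irrefl inj])
       (use inj in \<open>auto simp: Hs_def Ea_def inj_on_def\<close>)
  have outH: "?out v = m * q + optimal_colouring Hs Ea (ident v)"
    if "v \<in> V" "D \<le> card (nbrs V E v)" for v
    using that own[OF that(1)] by (simp add: out output_colour_def Hs Ea)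
  have outHlt: "optimal_colouring Hs Ea (ident v) < chromatic_number V E"
    if "v \<in> V" "D \<le> card (nbrs V E v)" for v
  proof -
    have "ident v \<in> Hs" using that by (auto simp: Hs_def)
    then show ?thesis using opt chi by (fastforce simp: proper_colouring_def)
  qed
  have outL: "\<exists>p<m. ?out v = p * q + code (ident v) p \<and>
      (\<forall>u \<in> nbrs V E v. card (nbrs V E u) < D \<longrightarrow> code (ident v) p \<noteq> code (ident u) p)"
    if v: "v \<in> V" "card (nbrs V E v) < D" for v
  proof -
    define J where "J = S v `` {ident v} - high_ids D (S v)"
    \<comment> \<open>With \<open>1 \<le> T\<close> the degrees of all neighbours are known exactly,
      so the set \<open>J\<close> below consists of the low-degree neighbours.\<close>
    have nb: "nbrs V E v \<subseteq> hops V E T v"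
      using hops_mono[OF T, of V E v] hops_1[of _ V E v] by blast
    have J: "J = ident ` {u \<in> nbrs V E v. card (nbrs V E u) < D}"
    proof -
      have "S v `` {ident v} = ident ` nbrs V E v"
        using Simg[OF v(1) v(1)] self_in_hops[of v V E T] by simp
      moreover have "ident u \<in> high_ids D (S v) \<longleftrightarrow> D \<le> card (nbrs V E u)"
        if "u \<in> nbrs V E v" for u
        using high[OF v(1), of u] that nb nV[of v] by blast
      ultimately show ?thesis
        unfolding J_def by (auto simp: not_le)
    qed
    define B where "B = (\<Union>u\<in>nbrs V E v. {p. p < m \<and> code (ident v) p = code (ident u) p})"
    have ne: "ident v \<noteq> ident u" if "u \<in> nbrs V E v" for u
      using that inj irrefl v(1) by (auto simp: nbrs_def inj_on_def)
    have "card B \<le> (\<Sum>u\<in>nbrs V E v. card {p. p < m \<and> code (ident v) p = code (ident u) p})"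
      unfolding B_def using V by (intro card_UN_le finite_nbrs)
    also have "\<dots> \<le> (\<Sum>u\<in>nbrs V E v. a)"
      using ne lt v(1) nV[of v] by (intro sum_mono less_imp_le code(2)) auto
    also have "\<dots> = a * card (nbrs V E v)" by simp
    also have "\<dots> < a * D" using v D by simp
    also have "\<dots> \<le> m" by fact
    finally have "card B < card {..<m}" by simp
    then have "\<not> {..<m} \<subseteq> B"
      using card_mono[of B "{..<m}"] V by (auto simp: B_def finite_nbrs)
    then obtain p where p: "p < m" "p \<notin> B" by auto
    have ex: "\<exists>p. p < m \<and> (\<forall>j\<in>J. code (ident v) p \<noteq> code j p)"
      using p by (intro exI[of _ p]) (auto simp: B_def J)
    define p0 where "p0 = free_position D m code (ident v) (S v)"
    have p0: "p0 < m \<and> (\<forall>j\<in>J. code (ident v) p0 \<noteq> code j p0)"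
      unfolding p0_def free_position_def J_def[symmetric] using ex by (rule LeastI_ex)
    have "?out v = p0 * q + code (ident v) p0"
      using own[OF v(1)] v by (simp add: out output_colour_def p0_def)
    then show ?thesis using p0 by (intro exI[of _ p0]) (auto simp: J)
  qed
  have outLlt: "?out v < m * q" if vL: "v \<in> V" "card (nbrs V E v) < D" for v
  proof -
    obtain p where p: "p < m" "?out v = p * q + code (ident v) p"
      using outL[OF vL] by blast
    then have "?out v < Suc p * q" using code(1)[OF lt[OF vL(1)], of p] by simp
    also have "\<dots> \<le> m * q" using p by (intro mult_right_mono) auto
    finally show ?thesis .
  qed
  show ?thesis
    unfolding proper_colouring_def
  proof (intro conjI ballI impI)
    fix v assume v: "v \<in> V"
    show "?out v < m * q + chromatic_number V E"
      using outH[OF v] outHlt[OF v] outLlt[OF v] by (cases "D \<le> card (nbrs V E v)") auto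
  next
    fix u v assume uv: "u \<in> V" "v \<in> V" "E u v"
    consider "D \<le> card (nbrs V E u)" "D \<le> card (nbrs V E v)"
      | "card (nbrs V E u) < D" "card (nbrs V E v) < D"
      | "D \<le> card (nbrs V E u)" "card (nbrs V E v) < D"
      | "card (nbrs V E u) < D" "D \<le> card (nbrs V E v)" by linarith
    then show "?out u \<noteq> ?out v"
    proof cases
      case 1
      then have "ident u \<in> Hs" "ident v \<in> Hs" "Ea (ident u) (ident v)"
        using uv by (auto simp: Hs_def Ea_def)
      then show ?thesis using opt outH 1 uv by (auto simp: proper_colouring_def)
    next
      case 2
      obtain p where p: "p < m" "?out u = p * q + code (ident u) p"
          "\<And>w. w \<in> nbrs V E u \<Longrightarrow> card (nbrs V E w) < D \<Longrightarrow> code (ident u) p \<noteq> code (ident w) p"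
        using outL[OF uv(1) 2(1)] by blast
      obtain p' where p': "p' < m" "?out v = p' * q + code (ident v) p'"
        using outL[OF uv(2) 2(2)] by blast
      have lts: "code (ident u) p < q" "code (ident v) p' < q"
        using code(1) lt uv p(1) p'(1) by auto
      have v: "v \<in> nbrs V E u" using uv by (simp add: nbrs_def)
      show ?thesis
      proof
        assume eq: "?out u = ?out v"
        \<comment> \<open>Equal colours mean equal position and equal symbol, which the position
          chosen by \<open>u\<close> excludes for its low-degree neighbour \<open>v\<close>.\<close>
        have "?out u div q = p" "?out u mod q = code (ident u) p"
          "?out v div q = p'" "?out v mod q = code (ident v) p'"
          unfolding p(2) p'(2) using lts by auto
        then show False using p(3)[OF v 2(2)] eq by auto
      qed
    next
      case 3
      then show ?thesis using outH[OF uv(1)] outLlt[OF uv(2)] by auto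
    next
      case 4
      then show ?thesis using outH[OF uv(2)] outLlt[OF uv(1)] by auto
    qed
  qed
qed

section \<open>Poisson tails\<close>

lemma poisson_process_prob:
  assumes "poisson_point_process P \<mu> X" "B \<in> sets \<mu>"
  shows "measure P {\<omega>\<in>space P. card (X \<omega> \<inter> B) = k} = exp (- measure \<mu> B) * measure \<mu> B ^ k / fact k"
  using assms by (simp add: poisson_point_process_def)

lemma poisson_process_sets:
  assumes "poisson_point_process P \<mu> X" "B \<in> sets \<mu>"
  shows "{\<omega>\<in>space P. Q (card (X \<omega> \<inter> B))} \<in> sets P"
proof -
  have "(\<lambda>\<omega>. card (X \<omega> \<inter> B)) \<in> measurable P (count_space UNIV)"
    using assms by (simp add: poisson_point_process_def)
  from measurable_sets[OF this, of "Collect Q"] show ?thesis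
    by (simp add: vimage_def Int_def conj_commute)
qed

lemma sums_exp_real: "(\<lambda>j. x ^ j / fact j) sums exp (x::real)"
  using exp_converges[of x] by (simp only: real_scaleR_def divide_inverse_commute)

text \<open>Markov's inequality for 2^(-N), where N is the count: its expectation is exp of minus
  half the mean. Termwise, 2^j is replaced by 2^k for j \<le> k.\<close>

lemma poisson_process_lower_tail:
  assumes "poisson_point_process P \<mu> X" "B \<in> sets \<mu>"
  shows "measure P {\<omega>\<in>space P. card (X \<omega> \<inter> B) \<le> k} \<le> 2 ^ k * exp (- measure \<mu> B / 2)"
proof -
  interpret prob_space P using assms(1) by (simp add: poisson_point_process_def)
  define l where "l = measure \<mu> B"
  have l: "l \<ge> 0" by (simp add: l_def)
  have "measure P {\<omega>\<in>space P. card (X \<omega> \<inter> B) \<le> k}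
      = measure P (\<Union>j\<in>{..k}. {\<omega>\<in>space P. card (X \<omega> \<inter> B) = j})"
    by (intro arg_cong[of _ _ "measure P"]) auto
  also have "\<dots> \<le> (\<Sum>j\<le>k. measure P {\<omega>\<in>space P. card (X \<omega> \<inter> B) = j})"
    using poisson_process_sets[OF assms] by (intro finite_measure_subadditive_finite) auto
  also have "\<dots> = (\<Sum>j\<le>k. exp (- l) * l ^ j / fact j)"
    using poisson_process_prob[OF assms] by (simp add: l_def)
  also have "\<dots> \<le> (\<Sum>j\<le>k. exp (- l) * 2 ^ k * ((l / 2) ^ j / fact j))"
  proof (rule sum_mono)
    fix j assume "j \<in> {..k}"
    then have "(2::real) ^ j \<le> 2 ^ k" by simp
    then have "exp (- l) / fact j * (l / 2) ^ j * 2 ^ j \<le> exp (- l) / fact j * (l / 2) ^ j * 2 ^ k"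
      using l by (intro mult_left_mono) auto
    then show "exp (- l) * l ^ j / fact j \<le> exp (- l) * 2 ^ k * ((l / 2) ^ j / fact j)"
      by (simp add: power_divide field_simps)
  qed
  also have "\<dots> = exp (- l) * 2 ^ k * (\<Sum>j\<le>k. (l / 2) ^ j / fact j)"
    by (simp add: sum_distrib_left)
  also have "\<dots> \<le> exp (- l) * 2 ^ k * exp (l / 2)"
  proof (rule mult_left_mono)
    show "(\<Sum>j\<le>k. (l / 2) ^ j / fact j) \<le> exp (l / 2)"
      using sum_le_suminf[of "\<lambda>j. (l / 2) ^ j / fact j" "{..k}"] sums_exp_real[of "l / 2"] l by (auto simp: sums_iff)
  qed auto
  also have "\<dots> = 2 ^ k * exp (- l / 2)"
  proof -
    have "exp (- l / 2) = exp (- l) * exp (l / 2)"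
      unfolding exp_add[symmetric] by (rule arg_cong[of _ _ exp]) simp
    then show ?thesis by simp
  qed
  finally show ?thesis by (simp add: l_def)
qed

text \<open>Markov's inequality for 2^N, whose expectation is exp of the mean. Termwise, a factor
  2^j \<ge> 1 is inserted into the series shifted by \<open>k\<close>.\<close>

lemma poisson_process_upper_tail:
  assumes "poisson_point_process P \<mu> X" "B \<in> sets \<mu>"
  shows "measure P {\<omega>\<in>space P. k \<le> card (X \<omega> \<inter> B)} \<le> exp (measure \<mu> B) / 2 ^ k"
proof -
  interpret prob_space P using assms(1) by (simp add: poisson_point_process_def)
  define l where "l = measure \<mu> B"
  have l: "l \<ge> 0" by (simp add: l_def)
  define N where "N = (\<lambda>j. {\<omega>\<in>space P. card (X \<omega> \<inter> B) = j + k})"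
  have "(\<lambda>j. measure P (N j)) sums measure P (\<Union>j. N j)"
    using poisson_process_sets[OF assms] 
    by (intro finite_measure_UNION) (auto simp: N_def disjoint_family_on_def)
  moreover have "(\<Union>j. N j) = {\<omega>\<in>space P. k \<le> card (X \<omega> \<inter> B)}"
    by (auto simp: N_def) (metis add.commute le_Suc_ex)
  moreover have "measure P (N j) = exp (- l) * l ^ (j + k) / fact (j + k)" for j
    using poisson_process_prob[OF assms, of "j + k"] by (simp add: N_def l_def)
  ultimately have s1: "(\<lambda>j. exp (- l) * l ^ (j + k) / fact (j + k)) sums
      measure P {\<omega>\<in>space P. k \<le> card (X \<omega> \<inter> B)}" by simp
  have s2: "(\<lambda>j. exp (- l) / 2 ^ k * ((2 * l) ^ (j + k) / fact (j + k))) sums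
     (exp (- l) / 2 ^ k * (exp (2 * l) - (\<Sum>j<k. (2 * l) ^ j / fact j)))"
    by (intro sums_mult sums_iff_shift[THEN iffD2]) (simp only: diff_add_cancel sums_exp_real)
  have "measure P {\<omega>\<in>space P. k \<le> card (X \<omega> \<inter> B)}
      \<le> exp (- l) / 2 ^ k * (exp (2 * l) - (\<Sum>j<k. (2 * l) ^ j / fact j))"
  proof (rule sums_le[OF _ s1 s2])
    fix j
    have "exp (- l) * l ^ (j + k) / fact (j + k) * 1 \<le> exp (- l) * l ^ (j + k) / fact (j + k) * 2 ^ j"
      using l by (intro mult_left_mono) auto
    then show "exp (- l) * l ^ (j + k) / fact (j + k)
        \<le> exp (- l) / 2 ^ k * ((2 * l) ^ (j + k) / fact (j + k))"
      by (simp add: power_mult_distrib power_add field_simps)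
  qed
  also have "\<dots> \<le> exp (- l) / 2 ^ k * exp (2 * l)"
    using l by (intro mult_left_mono) (auto intro!: sum_nonneg)
  also have "\<dots> = exp l / 2 ^ k"
  proof -
    have "exp l = exp (- l) * exp (2 * l)"
      unfolding exp_add[symmetric] by (rule arg_cong[of _ _ exp]) simp
    then show ?thesis by simp
  qed
  finally show ?thesis by (simp add: l_def)
qed

section \<open>Boxes of radius times angle and their intensity\<close>

definition circle_arc :: "nat \<Rightarrow> nat \<Rightarrow> real set" where
  "circle_arc M j = {2 * pi * real j / real M..<2 * pi * (real j + 1) / real M}"

definition hyp_box :: "real \<Rightarrow> nat \<Rightarrow> nat \<Rightarrow> (real \<times> real) set" where
  "hyp_box \<rho> M j = {0..\<rho>} \<times> circle_arc M j"

lemma arc_subset: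
  assumes "j < M"
  shows "circle_arc M j \<subseteq> {0..<2 * pi}"
proof -
  have "2 * pi * (real j + 1) / M \<le> 2 * pi * M / M"
    using assms by (intro divide_right_mono mult_left_mono) auto
  then show ?thesis using assms by (auto simp: circle_arc_def)
qed

lemma arc_exists:
  assumes "0 < M" "0 \<le> \<phi>" "\<phi> < 2 * pi"
  obtains j where "j < M" "\<phi> \<in> circle_arc M j"
proof -
  define j where "j = nat \<lfloor>\<phi> * M / (2 * pi)\<rfloor>"
  have j: "real j \<le> \<phi> * M / (2 * pi)" "\<phi> * M / (2 * pi) < real j + 1"
    using assms by (auto simp: j_def)
  then have "2 * pi * j / M \<le> \<phi>" "\<phi> < 2 * pi * (j + 1) / M"
    using assms(1) by (auto simp: field_simps)
  moreover have "real j < M"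
  proof -
    have "\<phi> * M / (2 * pi) < M" using assms by (simp add: field_simps)
    then show ?thesis using j by linarith
  qed
  ultimately show ?thesis using that[of j] by (simp add: circle_arc_def add.commute)
qed

text \<open>By Tonelli the mean factors into the arc length \<open>2 * pi / M\<close> and a radial
  integral, whose integrand is up to a constant the derivative of
  \<open>cosh (\<alpha> * r)\<close>.\<close>

lemma measure_hyp_box:
  assumes "0 < \<alpha>" "0 \<le> \<rho>" "\<rho> \<le> hrg_radius n C" "0 < hrg_radius n C" "j < M"
  shows "hyp_box \<rho> M j \<in> sets (hrg_intensity n \<alpha> C)"
    and "measure (hrg_intensity n \<alpha> C) (hyp_box \<rho> M j) =
      n / M * ((cosh (\<alpha> * \<rho>) - 1) / (cosh (\<alpha> * hrg_radius n C) - 1))"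
proof -
  let ?R = "hrg_radius n C"
  have sub: "hyp_box \<rho> M j \<subseteq> hyp_disk ?R"
    using arc_subset[OF assms(5)] assms(3) by (auto simp: hyp_box_def hyp_disk_def)
  have D: "hyp_disk ?R \<in> sets borel"
    unfolding hyp_disk_def borel_prod[symmetric] by simp
  have B: "hyp_box \<rho> M j \<in> sets borel"
    unfolding hyp_box_def circle_arc_def borel_prod[symmetric] by simp
  have BD: "hyp_box \<rho> M j \<in> sets (restrict_space lborel (hyp_disk ?R))"
    using sub B D by (subst sets_restrict_space_iff) auto
  then show S: "hyp_box \<rho> M j \<in> sets (hrg_intensity n \<alpha> C)"
    by (simp add: hrg_intensity_def)
  define f where "f = (\<lambda>r. real n * hrg_density \<alpha> ?R r)"
  define K where "K = real n / (2 * pi * (cosh (\<alpha> * ?R) - 1))"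
  define F where "F = (\<lambda>r. K * cosh (\<alpha> * r))"
  have pos: "cosh (\<alpha> * ?R) - 1 > 0"
    using assms(1,4) cosh_real_strict_mono[of 0 "\<alpha> * ?R"] by simp
  have f_eq: "f r = real n / (2 * pi * (cosh (\<alpha> * ?R) - 1)) * (sinh (\<alpha> * r) * \<alpha>)" for r
    by (simp add: f_def hrg_density_def)
  have f_meas [measurable]: "f \<in> borel_measurable borel"
    unfolding f_eq by (intro borel_measurable_continuous_onI continuous_intros)
  have f_nonneg: "f r \<ge> 0" if "r \<ge> 0" for r
    using that pos assms(1) by (auto simp: f_def hrg_density_def)
  have "emeasure (hrg_intensity n \<alpha> C) (hyp_box \<rho> M j) =
     (\<integral>\<^sup>+x. ennreal (f (fst x)) * indicator (hyp_box \<rho> M j) x \<partial>restrict_space lborel (hyp_disk ?R))"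
  proof -
    have "(\<lambda>x. ennreal (f (fst x))) \<in> borel_measurable (restrict_space lborel (hyp_disk ?R))"
      by (intro measurable_restrict_space1) (simp flip: borel_prod)
    then show ?thesis
      unfolding hrg_intensity_def f_def by (intro emeasure_density BD)
  qed
  also have "\<dots> = (\<integral>\<^sup>+x. ennreal (f (fst x)) * indicator (hyp_box \<rho> M j) x * indicator (hyp_disk ?R) x \<partial>lborel)"
    using D by (subst nn_integral_restrict_space) auto
  also have "\<dots> = (\<integral>\<^sup>+x. (ennreal (f (fst x)) * indicator {0..\<rho>} (fst x)) * indicator (circle_arc M j) (snd x) \<partial>(lborel \<Otimes>\<^sub>M lborel))"
    unfolding lborel_prod using sub
    by (intro nn_integral_cong) (auto simp: hyp_box_def indicator_def split: if_splits)
  also have "\<dots> = (\<integral>\<^sup>+r. (\<integral>\<^sup>+\<phi>. (ennreal (f r) * indicator {0..\<rho>} r) * indicator (circle_arc M j) \<phi> \<partial>lborel) \<partial>lborel)"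
    by (subst lborel.nn_integral_fst[symmetric]) (auto simp: circle_arc_def)
  also have "\<dots> = (\<integral>\<^sup>+r. (ennreal (f r) * indicator {0..\<rho>} r) * ennreal (2 * pi / M) \<partial>lborel)"
  proof (intro nn_integral_cong)
    fix r :: real
    have "emeasure lborel (circle_arc M j) = ennreal (2 * pi / M)"
      using assms(5) unfolding circle_arc_def
      by (subst emeasure_lborel_Ico) (auto simp: field_simps divide_right_mono)
    then show "(\<integral>\<^sup>+\<phi>. (ennreal (f r) * indicator {0..\<rho>} r) * indicator (circle_arc M j) \<phi> \<partial>lborel)
      = (ennreal (f r) * indicator {0..\<rho>} r) * ennreal (2 * pi / M)"
      by (subst nn_integral_cmult) (auto simp: circle_arc_def)
  qed
  also have "\<dots> = (\<integral>\<^sup>+r. ennreal (f r) * indicator {0..\<rho>} r \<partial>lborel) * ennreal (2 * pi / M)"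
    by (subst nn_integral_multc) auto
  also have "(\<integral>\<^sup>+r. ennreal (f r) * indicator {0..\<rho>} r \<partial>lborel) = ennreal (F \<rho> - F 0)"
  proof (rule nn_integral_FTC_Icc)
    fix r assume r: "r \<in> {0..\<rho>}"
    show "(F has_real_derivative f r) (at r)"
      unfolding F_def f_eq K_def[symmetric] by (auto intro!: derivative_eq_intros)
    show "f r \<ge> 0" using r by (intro f_nonneg) simp
  qed (use assms in auto)
  also have "F \<rho> - F 0 = K * (cosh (\<alpha> * \<rho>) - 1)"
    by (simp add: F_def right_diff_distrib)
  also have "\<dots> = real n / (2 * pi) * ((cosh (\<alpha> * \<rho>) - 1) / (cosh (\<alpha> * ?R) - 1))"
    by (simp add: K_def)
  also have "ennreal \<dots> * ennreal (2 * pi / M) = ennreal (\<dots> * (2 * pi / M))"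
    using pos cosh_real_ge_1[of "\<alpha> * \<rho>"] by (intro ennreal_mult[symmetric]) auto
  also have "real n / (2 * pi) * ((cosh (\<alpha> * \<rho>) - 1) / (cosh (\<alpha> * ?R) - 1)) * (2 * pi / M)
     = n / M * ((cosh (\<alpha> * \<rho>) - 1) / (cosh (\<alpha> * ?R) - 1))"
    by simp
  finally show "measure (hrg_intensity n \<alpha> C) (hyp_box \<rho> M j) =
      n / M * ((cosh (\<alpha> * \<rho>) - 1) / (cosh (\<alpha> * hrg_radius n C) - 1))"
    using pos cosh_real_ge_1[of "\<alpha> * \<rho>"] by (intro measure_eq_emeasure_eq_ennreal) auto
qed

section \<open>Hyperbolic geometry\<close>

text \<open>This separates a radial and an angular term, both nonnegative, which can be bounded
  independently. Their sum is at least 1, so \<open>arcosh\<close> can be inverted.\<close>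

lemma hyp_dist_le_iff:
  assumes "0 \<le> R" "0 \<le> r" "0 \<le> s"
  shows "hyp_dist (r, \<phi>) (s, \<psi>) \<le> R \<longleftrightarrow>
    cosh (r - s) + sinh r * sinh s * (1 - cos (\<phi> - \<psi>)) \<le> cosh R"
proof -
  let ?z = "cosh (r - s) + sinh r * sinh s * (1 - cos (\<phi> - \<psi>))"
  have z: "cosh r * cosh s - sinh r * sinh s * cos (\<phi> - \<psi>) = ?z"
    by (simp add: cosh_diff algebra_simps)
  have "0 \<le> sinh r * sinh s * (1 - cos (\<phi> - \<psi>))"
    using assms by simp
  then have "1 \<le> ?z" using cosh_real_ge_1[of "r - s"] by linarith
  then have "arcosh ?z \<le> R \<longleftrightarrow> ?z \<le> cosh R"
    using cosh_real_nonneg_le_iff[of "arcosh ?z" R] assms(1) by simp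
  then show ?thesis by (simp add: hyp_dist_def z)
qed

lemma hyp_dist_commute: "hyp_dist x y = hyp_dist y x"
  using cos_minus[of "snd x - snd y"] by (simp add: hyp_dist_def mult.commute mult.left_commute)

text \<open>The worst case is opposite angles, where the expression becomes
  \<open>cosh (r + s)\<close>.\<close>

lemma hyp_dist_core:
  assumes "0 \<le> r" "0 \<le> s" "r \<le> R / 2" "s \<le> R / 2"
  shows "hyp_dist (r, \<phi>) (s, \<psi>) \<le> R"
proof -
  have "sinh r * sinh s * (1 - cos (\<phi> - \<psi>)) \<le> sinh r * sinh s * 2"
    using assms cos_ge_minus_one[of "\<phi> - \<psi>"] by (intro mult_left_mono) (auto intro: mult_nonneg_nonneg)
  then have "cosh (r - s) + sinh r * sinh s * (1 - cos (\<phi> - \<psi>)) \<le> cosh (r + s)"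
    by (simp add: cosh_diff cosh_add)
  also have "\<dots> \<le> cosh R"
    using assms by (subst cosh_real_nonneg_le_iff) auto
  finally show ?thesis
    using assms by (subst hyp_dist_le_iff) auto
qed

lemma sinh_le_half_exp: "sinh (x::real) \<le> exp x / 2"
  by (simp add: sinh_field_def)

lemma cosh_ge_half_exp: "exp x / 2 \<le> cosh (x::real)"
  by (simp add: cosh_field_def)

lemma cosh_le_exp_abs: "cosh (x::real) \<le> exp \<bar>x\<bar>"
  by (cases "x \<ge> 0") (auto simp: cosh_field_def)

lemma sinh_ge_quarter_exp:
  assumes "(1::real) \<le> x"
  shows "exp x / 4 \<le> sinh x"
proof -
  have "2 \<le> exp x" using exp_ge_add_one_self[of x] assms by linarith
  moreover have "2 * exp (- x) \<le> 2 * 1" using assms by (intro mult_left_mono) auto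
  ultimately have "2 * exp (- x) \<le> exp x" by linarith
  then show ?thesis by (simp add: sinh_field_def field_simps)
qed

lemma one_minus_cos: "1 - cos x = 2 * (sin (x / 2))\<^sup>2" for x :: real
  using cos_double_sin[of "x / 2"] by simp

lemma one_minus_cos_le: "1 - cos x \<le> x\<^sup>2 / 2" for x :: real
proof -
  have "(sin (x / 2))\<^sup>2 \<le> (x / 2)\<^sup>2"
    using abs_sin_x_le_abs_x[of "x / 2"] by (simp only: abs_le_square_iff)
  then show ?thesis by (simp add: one_minus_cos power_divide)
qed

text \<open>Jordan's inequality: by concavity the sine lies above its chord from \<open>0\<close> to
  \<open>pi / 2\<close>.\<close>

lemma one_minus_cos_ge:
  fixes x :: real
  assumes "0 \<le> x" "x \<le> pi"
  shows "2 * (x / pi)\<^sup>2 \<le> 1 - cos x"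
proof -
  have "concave_on {0..pi} (sin :: real \<Rightarrow> real)"
  proof (rule f''_le0_imp_concave)
    show "(sin has_real_derivative cos x) (at x)" "(cos has_real_derivative - sin x) (at x)" for x :: real
      by (auto intro!: derivative_eq_intros)
    show "- sin x \<le> 0" if "x \<in> {0..pi}" for x using that sin_ge_zero[of x] by simp
  qed simp
  from concave_onD[OF this, of "x / pi" 0 "pi / 2"] have "x / pi \<le> sin (x / 2)"
    using assms by (simp add: field_simps)
  then have "(x / pi)\<^sup>2 \<le> (sin (x / 2))\<^sup>2"
    using assms by (intro power_mono) auto
  then show ?thesis by (simp add: one_minus_cos)
qed

text \<open>The exponents of the three factors of the angular term add up to exactly
  \<open>R\<close>, so this term is at most \<open>exp R / 8\<close>. The radial term is at most
  \<open>exp R / 4\<close> because the radii differ by at most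
  \<open>(1 - \<delta>) * R\<close>.\<close>

lemma hyp_dist_near:
  assumes "0 \<le> r" "r \<le> (1 - t) * R" "0 \<le> s" "s \<le> (1 - t') * R" "0 \<le> R" "\<delta> \<le> t" "\<delta> \<le> t'"
    and \<phi>: "\<bar>\<phi> - \<psi>\<bar> \<le> exp ((t + t' - 1) * R / 2)" and big: "4 * exp ((1 - \<delta>) * R) \<le> exp R"
  shows "hyp_dist (r, \<phi>) (s, \<psi>) \<le> R"
proof -
  have "(1 - t) * R \<le> (1 - \<delta>) * R" "(1 - t') * R \<le> (1 - \<delta>) * R"
    using assms by (auto intro!: mult_right_mono)
  then have rs: "\<bar>r - s\<bar> \<le> (1 - \<delta>) * R" using assms by linarith
  have "cosh (r - s) \<le> exp \<bar>r - s\<bar>" by (rule cosh_le_exp_abs)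
  also have "\<dots> \<le> exp R / 4" 
  proof -
    have "exp \<bar>r - s\<bar> \<le> exp ((1 - \<delta>) * R)" using rs by simp
    then show ?thesis using big by linarith
  qed
  finally have 1: "cosh (r - s) \<le> exp R / 4" .
  have "1 - cos (\<phi> - \<psi>) \<le> \<bar>\<phi> - \<psi>\<bar>\<^sup>2 / 2"
    using one_minus_cos_le[of "\<phi> - \<psi>"] by simp
  also have "\<dots> \<le> (exp ((t + t' - 1) * R / 2))\<^sup>2 / 2"
    using \<phi> by (intro divide_right_mono power_mono) auto
  also have "(exp ((t + t' - 1) * R / 2))\<^sup>2 = exp ((t + t' - 1) * R)"
    by (simp flip: exp_double)
  finally have 2: "1 - cos (\<phi> - \<psi>) \<le> exp ((t + t' - 1) * R) / 2" .
  have "sinh r * sinh s * (1 - cos (\<phi> - \<psi>)) \<le>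
      (exp ((1 - t) * R) / 2) * (exp ((1 - t') * R) / 2) * (exp ((t + t' - 1) * R) / 2)"
  proof (intro mult_mono 2)
    have "exp r \<le> exp ((1 - t) * R)" "exp s \<le> exp ((1 - t') * R)" using assms by auto
    then show "sinh r \<le> exp ((1 - t) * R) / 2" "sinh s \<le> exp ((1 - t') * R) / 2"
      using sinh_le_half_exp[of r] sinh_le_half_exp[of s] by linarith+
  qed (use assms in auto)
  also have "\<dots> = exp ((1 - t) * R + (1 - t') * R + (t + t' - 1) * R) / 8"
    by (simp add: exp_add)
  also have "(1 - t) * R + (1 - t') * R + (t + t' - 1) * R = R"
    by (simp add: algebra_simps)
  finally have "cosh (r - s) + sinh r * sinh s * (1 - cos (\<phi> - \<psi>)) \<le> exp R / 4 + exp R / 8"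
    using 1 by linarith
  also have "\<dots> \<le> cosh R" using cosh_ge_half_exp[of R] exp_gt_zero[of R] by linarith
  finally show ?thesis using assms by (subst hyp_dist_le_iff) auto
qed

text \<open>The angular term alone is at most \<open>cosh R\<close>. The two bounds
  \<open>exp / 4\<close> for \<open>sinh\<close> and the quadratic bound for the cosine give the
  constant \<open>8 * pi\<^sup>2\<close>, which 10 squared covers.\<close>

lemma hyp_dist_le_imp_angle:
  assumes "1 \<le> r" "1 \<le> s" "0 \<le> R" "\<phi> \<in> {0..<2 * pi}" "\<psi> \<in> {0..<2 * pi}"
    and d: "hyp_dist (r, \<phi>) (s, \<psi>) \<le> R" and \<theta>: "10 * exp ((R - r - s) / 2) \<le> \<theta>"
  shows "\<bar>\<phi> - \<psi>\<bar> \<le> \<theta> \<or> 2 * pi - \<theta> \<le> \<bar>\<phi> - \<psi>\<bar>"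
proof -
  \<comment> \<open>The distance on the circle, which lies in the range of
    \<open>one_minus_cos_ge\<close>.\<close>
  define x where "x = min \<bar>\<phi> - \<psi>\<bar> (2 * pi - \<bar>\<phi> - \<psi>\<bar>)"
  have lt: "\<bar>\<phi> - \<psi>\<bar> < 2 * pi" using assms(4,5) by (simp add: abs_less_iff)
  then have x: "0 \<le> x" "x \<le> pi" by (auto simp: x_def min_def)
  have "cos x = cos \<bar>\<phi> - \<psi>\<bar>"
    unfolding x_def min_def by (simp add: cos_diff)
  then have cos: "cos x = cos (\<phi> - \<psi>)" by (simp add: cos_abs_real)
  have "(exp r / 4) * (exp s / 4) * (1 - cos x) \<le> sinh r * sinh s * (1 - cos x)"
    using assms(1,2) by (intro mult_right_mono mult_mono sinh_ge_quarter_exp) auto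
  also have "\<dots> \<le> cosh R"
    using d assms(1,2,3) cosh_real_ge_1[of "r - s"] by (simp add: hyp_dist_le_iff cos)
  also have "\<dots> \<le> exp R" using cosh_le_exp_abs[of R] assms(3) by simp
  finally have "1 - cos x \<le> 16 * (exp R / (exp r * exp s))"
    by (simp add: field_simps)
  also have "exp R / (exp r * exp s) = exp ((R - r - s) / 2) ^ 2"
  proof -
    have "2 * ((R - r - s) / 2) = R - (r + s)" by simp
    then show ?thesis by (simp only: exp_double[symmetric] exp_diff exp_add)
  qed
  finally have "2 * (x / pi)\<^sup>2 \<le> 16 * exp ((R - r - s) / 2) ^ 2"
    using one_minus_cos_ge[OF x] by linarith
  then have "x\<^sup>2 \<le> 8 * pi\<^sup>2 * exp ((R - r - s) / 2) ^ 2"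
    by (simp add: field_simps power_divide)
  also have "\<dots> \<le> 10\<^sup>2 * exp ((R - r - s) / 2) ^ 2"
  proof (rule mult_right_mono)
    have "pi * pi \<le> 3.2 * 3.2"
      using pi_approx by (intro mult_mono) auto
    then show "8 * pi\<^sup>2 \<le> 10\<^sup>2" by (simp add: power2_eq_square)
  qed simp
  also have "\<dots> = (10 * exp ((R - r - s) / 2))\<^sup>2"
    by (simp only: power_mult_distrib)
  finally have "x \<le> 10 * exp ((R - r - s) / 2)"
    by (rule power2_le_imp_le) simp
  then show ?thesis using \<theta> by (auto simp: x_def min_def split: if_splits)
qed

lemma same_arc: "\<phi> \<in> circle_arc M j \<Longrightarrow> \<psi> \<in> circle_arc M j \<Longrightarrow> \<bar>\<phi> - \<psi>\<bar> \<le> 2 * pi / M"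
  by (auto simp: circle_arc_def abs_le_iff ring_distribs add_divide_distrib)

text \<open>The arcs \<open>0\<close> and \<open>M - 1\<close> account for the jump of the angle at \<open>2 \<pi>\<close>.\<close>

lemma near_arcs:
  assumes "\<phi> \<in> circle_arc M j" "\<psi> \<in> circle_arc M k" "j < M" "k < M"
    and \<theta>: "\<theta> \<le> 2 * pi / M" and near: "\<bar>\<phi> - \<psi>\<bar> \<le> \<theta> \<or> 2 * pi - \<theta> \<le> \<bar>\<phi> - \<psi>\<bar>"
  shows "k \<in> {j - 1, j, Suc j, 0, M - 1}"
proof -
  define w where "w = 2 * pi / M"
  have w: "w > 0" "w * M = 2 * pi" using assms(3) by (auto simp: w_def)
  have arcs: "w * j \<le> \<phi>" "\<phi> < w * (real j + 1)" "w * k \<le> \<psi>" "\<psi> < w * (real k + 1)"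
    using assms(1,2) by (auto simp: circle_arc_def w_def)
  have idx: "w * a < w * b \<Longrightarrow> a < b" for a b using w by simp
  from near consider "\<bar>\<phi> - \<psi>\<bar> \<le> w" | "2 * pi - w \<le> \<phi> - \<psi>" | "2 * pi - w \<le> \<psi> - \<phi>"
    using \<theta> unfolding w_def by linarith
  then show ?thesis
  proof cases
    case 1
    have "w * k < w * (real j + 2)" "w * j < w * (real k + 2)"
      using 1 arcs by (auto simp: algebra_simps)
    then have "real k < real j + 2" "real j < real k + 2" using idx by blast+
    then show ?thesis by auto
  next
    case 2
    have "w * (real j + 1) \<le> w * M" using assms(3) w by (intro mult_left_mono) auto
    then have "w * k < w * 1" using 2 arcs w by linarith
    then have "real k < 1" by (rule idx)
    then show ?thesis by auto
  next
    case 3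
    have "0 \<le> w * j" using w by simp
    then have "w * real M < w * (real k + 2)"
      using 3 arcs w unfolding distrib_left by linarith
    then have "real M < real k + 2" by (rule idx)
    then show ?thesis using assms(4) by auto
  qed
qed

lemma hrg_adj_commute: "hrg_adj n C x y \<longleftrightarrow> hrg_adj n C y x"
  by (auto simp: hrg_adj_def hyp_dist_commute)

lemma hrg_core_clique:
  assumes "X \<subseteq> hyp_disk (hrg_radius n C)" "x \<in> X" "y \<in> X" "x \<noteq> y"
    "fst x \<le> hrg_radius n C / 2" "fst y \<le> hrg_radius n C / 2"
  shows "hrg_adj n C x y"
proof -
  have "0 \<le> fst x" "0 \<le> fst y" using assms(1-3) by (auto simp: hyp_disk_def)
  then show ?thesis
    using hyp_dist_core[of "fst x" "fst y" "hrg_radius n C" "snd x" "snd y"] assms(4-6)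
    by (simp add: hrg_adj_def)
qed

text \<open>Rounding up makes arcs no wider than \<open>w\<close>, so that points of one arc are
  close enough to be adjacent; the bounded number of arcs keeps the mean per box large.\<close>

lemma fine_arcs:
  assumes "0 < w" "w \<le> 1" "M = nat \<lceil>2 * pi / w\<rceil>"
  shows "0 < M" "2 * pi / M \<le> w" "M \<le> 4 * pi / w"
proof -
  have "1 \<le> 2 * pi / w" using assms(1,2) pi_gt3 by (simp add: field_simps)
  then have M: "2 * pi / w \<le> M" "real M \<le> 2 * pi / w + 1"
    using assms(3) by (auto intro: of_nat_ceiling)
  show "0 < M" using M(1) \<open>1 \<le> 2 * pi / w\<close> by (cases M) auto
  then show "2 * pi / M \<le> w" using M(1) assms(1) by (simp add: field_simps)
  have "2 * (2 * pi / w) = 4 * pi / w" by simp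
  then show "M \<le> 4 * pi / w" using M(2) \<open>1 \<le> 2 * pi / w\<close> by linarith
qed

text \<open>Rounding down makes arcs at least \<open>\<theta>\<close> wide, unless one arc is the
  whole circle, so that neighbours stay in adjacent arcs. Arcs at most \<open>2 * \<theta>\<close>
  wide keep the mean per box small.\<close>

lemma coarse_arcs:
  assumes "0 < \<theta>" "M = max 1 (nat \<lfloor>2 * pi / \<theta>\<rfloor>)"
  shows "0 < M" "M = 1 \<or> \<theta> \<le> 2 * pi / M" "1 / M \<le> \<theta> / pi" "M \<le> 1 + 2 * pi / \<theta>"
proof -
  define y where "y = 2 * pi / \<theta>"
  have y: "0 < y" "\<theta> = 2 * pi / y" using assms(1) by (auto simp: y_def)
  show M: "0 < M" using assms(2) by simp
  have My: "M = 1 \<or> real M \<le> y"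
    using assms(2) y(1) by (auto simp: y_def[symmetric] max_def)
  have "y < real M + 1"
    using assms(2) y(1) by (auto simp: y_def[symmetric] max_def) linarith+
  then have "y \<le> 2 * M" using M by linarith
  then have "1 / M \<le> 2 / y" using y(1) M by (simp add: field_simps)
  then show "1 / M \<le> \<theta> / pi" by (simp add: y(2))
  show "M = 1 \<or> \<theta> \<le> 2 * pi / M" using My y(1) M unfolding y(2) by (auto intro!: divide_left_mono)
  show "M \<le> 1 + 2 * pi / \<theta>" using My y(1) by (auto simp: y_def)
qed

text \<open>The angle allowed to a neighbour shrinks exponentially with its radius, so no single arc
  width fits. Across one of \<open>K\<close> radial layers it varies only by a factor exp (R / (2
  K)), and in each layer the neighbours lie in the at most 5 arcs of \<open>near_arcs\<close>. The
  boxes start at radius 0, which merely overcounts.\<close>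

lemma card_nbrs_far_le:
  fixes K k n :: nat and M :: "nat \<Rightarrow> nat" and C :: real
  defines "R \<equiv> hrg_radius n C"
  assumes X: "finite X" "X \<subseteq> hyp_disk R" and x: "x \<in> X" "(1 - \<delta>) * R < fst x"
    and big: "1 \<le> (1 - \<delta>) * R" "1 \<le> R / K" "0 < K" "0 \<le> \<delta>"
    and M: "\<And>i. i \<in> {1..K} \<Longrightarrow> 0 < M i"
      "\<And>i. i \<in> {1..K} \<Longrightarrow> M i = 1 \<or> 10 * exp ((\<delta> - (real i - 1) / K) * R / 2) \<le> 2 * pi / M i"
    and cells: "\<And>i j. i \<in> {1..K} \<Longrightarrow> j < M i \<Longrightarrow> card (X \<inter> hyp_box (i * R / K) (M i) j) \<le> k"
  shows "card (nbrs X (hrg_adj n C) x) \<le> 5 * K * k"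
proof -
  have R: "0 < R" using big by (auto simp: field_simps intro: less_le_trans[of 0 "real K"])
  obtain r \<phi> where x_eq: "x = (r, \<phi>)" by (cases x)
  have r: "1 \<le> r" "(1 - \<delta>) * R < r" "\<phi> \<in> {0..<2 * pi}"
    using x X big(1) by (auto simp: x_eq hyp_disk_def)
  have "\<forall>i\<in>{1..K}. \<exists>j<M i. \<phi> \<in> circle_arc (M i) j"
    using arc_exists[OF M(1)] r(3) by (metis atLeastLessThan_iff)
  then obtain j0 where j0: "\<And>i. i \<in> {1..K} \<Longrightarrow> j0 i < M i \<and> \<phi> \<in> circle_arc (M i) (j0 i)"
    by metis
  define J where "J = (\<lambda>i. {j0 i - 1, j0 i, Suc (j0 i), 0, M i - 1} \<inter> {..<M i})"
  have "nbrs X (hrg_adj n C) x \<subseteq> (\<Union>i\<in>{1..K}. \<Union>j\<in>J i. X \<inter> hyp_box (i * R / K) (M i) j)"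
  proof
    fix y assume "y \<in> nbrs X (hrg_adj n C) x"
    then have y: "y \<in> X" "hyp_dist x y \<le> R" by (auto simp: nbrs_def hrg_adj_def R_def)
    obtain s \<psi> where y_eq: "y = (s, \<psi>)" by (cases y)
    have s: "0 \<le> s" "s \<le> R" "\<psi> \<in> {0..<2 * pi}"
      using y X by (auto simp: y_eq hyp_disk_def)
    \<comment> \<open>The maximum puts radius 0, where the ceiling is 0, into the first
      layer.\<close>
    define i where "i = max 1 (nat \<lceil>s * K / R\<rceil>)"
    have "s * K \<le> R * K" using s(2) by (rule mult_right_mono) simp
    then have "s * K / R \<le> K" "0 \<le> s * K / R" using s R by (auto simp: field_simps)
    then have i: "i \<in> {1..K}" "s * K / R \<le> i" "i = 1 \<or> real i - 1 \<le> s * K / R"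
      using big(3) by (auto simp: i_def max_def ceiling_le_iff le_nat_iff nat_le_iff)
    have i': "s \<le> i * R / K" "i = 1 \<or> (real i - 1) * R / K \<le> s"
      using i(2,3) R big(3) by (auto simp: field_simps)
    obtain j where j: "j < M i" "\<psi> \<in> circle_arc (M i) j"
      using arc_exists[OF M(1)[OF i(1)], of \<psi>] s(3) by auto
    have "j \<in> {j0 i - 1, j0 i, Suc (j0 i), 0, M i - 1}"
    proof (cases "M i = 1")
      case True
      then show ?thesis using j by simp
    next
      case False
      then have \<theta>: "10 * exp ((\<delta> - (real i - 1) / K) * R / 2) \<le> 2 * pi / M i"
        using M(2)[OF i(1)] by blast
      \<comment> \<open>The angle bound requires \<open>1 \<le> s\<close>, which the first layer
        does not give. There, however, the required width is at least 10 > 2 pi, so a single arc is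
        used and this case cannot occur.\<close>
      have "i \<noteq> 1"
      proof
        assume "i = 1"
        then have "10 * exp (\<delta> * R / 2) \<le> 2 * pi / M i" using \<theta> by simp
        also have "\<dots> \<le> 2 * pi / 1" using M(1)[OF i(1)] by (intro divide_left_mono) auto
        finally have "10 * exp (\<delta> * R / 2) \<le> 2 * pi" by simp
        moreover have "1 \<le> exp (\<delta> * R / 2)" using big(4) R by simp
        ultimately show False using pi_less_4 by linarith
      qed
      then have i2: "1 \<le> real i - 1" "(real i - 1) * R / K \<le> s" using i(1) i'(2) by auto
      have "1 * (R / K) \<le> (real i - 1) * (R / K)"
        using i2(1) R by (intro mult_right_mono) auto
      then have "1 \<le> s" using i2(2) big(2) by simp
      have "(R - r - s) / 2 \<le> (\<delta> - (real i - 1) / K) * R / 2"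
      proof -
        have "(\<delta> - (real i - 1) / K) * R = \<delta> * R - (real i - 1) * R / K"
          by (simp add: left_diff_distrib)
        moreover have "R - \<delta> * R < r" using r(2) by (simp add: left_diff_distrib)
        ultimately have "R - r - s \<le> (\<delta> - (real i - 1) / K) * R" using i2(2) by linarith
        then show ?thesis by (rule divide_right_mono) simp
      qed
      then have "10 * exp ((R - r - s) / 2) \<le> 10 * exp ((\<delta> - (real i - 1) / K) * R / 2)"
        by simp
      then have "\<bar>\<phi> - \<psi>\<bar> \<le> 10 * exp ((\<delta> - (real i - 1) / K) * R / 2)
          \<or> 2 * pi - 10 * exp ((\<delta> - (real i - 1) / K) * R / 2) \<le> \<bar>\<phi> - \<psi>\<bar>"
        using \<open>1 \<le> s\<close> r s R y(2) unfolding x_eq y_eq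
        by (intro hyp_dist_le_imp_angle[of r s R]) auto
      then show ?thesis
        using j0[OF i(1)] j \<theta> by (intro near_arcs[of \<phi> _ _ \<psi>]) auto
    qed
    then show "y \<in> (\<Union>i\<in>{1..K}. \<Union>j\<in>J i. X \<inter> hyp_box (i * R / K) (M i) j)"
      using i(1) i'(1) j s(1) y(1) by (auto simp: J_def hyp_box_def y_eq)
  qed
  then have "card (nbrs X (hrg_adj n C) x)
      \<le> card (\<Union>i\<in>{1..K}. \<Union>j\<in>J i. X \<inter> hyp_box (i * R / K) (M i) j)"
    using X(1) by (intro card_mono) (auto simp: J_def)
  also have "\<dots> \<le> (\<Sum>i\<in>{1..K}. card (\<Union>j\<in>J i. X \<inter> hyp_box (i * R / K) (M i) j))"
    by (intro card_UN_le) auto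
  also have "\<dots> \<le> (\<Sum>i\<in>{1..K}. 5 * k)"
  proof (rule sum_mono)
    fix i assume i: "i \<in> {1..K}"
    have J5: "card (J i) \<le> 5"
    proof -
      have "card (J i) \<le> card {j0 i - 1, j0 i, Suc (j0 i), 0, M i - 1}"
        unfolding J_def by (intro card_mono) auto
      also have "\<dots> \<le> length [j0 i - 1, j0 i, Suc (j0 i), 0, M i - 1]"
        by (rule order.trans[OF _ card_length]) simp
      finally show ?thesis by simp
    qed
    have "card (\<Union>j\<in>J i. X \<inter> hyp_box (i * R / K) (M i) j)
        \<le> (\<Sum>j\<in>J i. card (X \<inter> hyp_box (i * R / K) (M i) j))"
      by (intro card_UN_le) (auto simp: J_def)
    also have "\<dots> \<le> (\<Sum>j\<in>J i. k)"
      using cells[OF i] by (intro sum_mono) (auto simp: J_def)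
    also have "\<dots> \<le> 5 * k" using J5 by simp
    finally show "card (\<Union>j\<in>J i. X \<inter> hyp_box (i * R / K) (M i) j) \<le> 5 * k" .
  qed
  finally show ?thesis by (simp add: mult.commute mult.left_commute)
qed

text \<open>A box over the arc of the current vertex is narrow enough for
  \<open>hyp_dist_near\<close>, so any point in it is a step to the next depth.\<close>

lemma near_core_hops:
  fixes t :: "nat \<Rightarrow> real" and M :: "nat \<Rightarrow> nat" and n :: nat and C :: real
  defines "R \<equiv> hrg_radius n C"
  assumes X: "X \<subseteq> hyp_disk R" and R: "0 \<le> R"
    and t: "\<And>k. k \<le> L \<Longrightarrow> \<delta> \<le> t k"
    and M: "\<And>k. k < L \<Longrightarrow> 0 < M k"
      "\<And>k. k < L \<Longrightarrow> 2 * pi / M k \<le> exp ((t k + t (Suc k) - 1) * R / 2)"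
    and cells: "\<And>k j. k < L \<Longrightarrow> j < M k \<Longrightarrow> X \<inter> hyp_box ((1 - t (Suc k)) * R) (M k) j \<noteq> {}"
    and big: "4 * exp ((1 - \<delta>) * R) \<le> exp R"
    and x: "x \<in> X" "fst x \<le> (1 - t 0) * R"
  shows "\<exists>y\<in>X. fst y \<le> (1 - t L) * R \<and> y \<in> hops X (hrg_adj n C) L x"
proof -
  have "k \<le> L \<Longrightarrow> \<exists>y\<in>X. fst y \<le> (1 - t k) * R \<and> y \<in> hops X (hrg_adj n C) k x" for k
  proof (induction k)
    case 0
    then show ?case using x by auto
  next
    case (Suc k)
    then obtain y where y: "y \<in> X" "fst y \<le> (1 - t k) * R" "y \<in> hops X (hrg_adj n C) k x"
      by auto
    obtain s \<psi> where y_eq: "y = (s, \<psi>)" by (cases y)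
    have s: "0 \<le> s" "0 \<le> \<psi>" "\<psi> < 2 * pi" using y X by (auto simp: y_eq hyp_disk_def)
    have k: "k < L" using Suc.prems by simp
    obtain j where j: "j < M k" "\<psi> \<in> circle_arc (M k) j"
      using arc_exists[OF M(1)[OF k] s(2,3)] by auto
    obtain z where z: "z \<in> X" "z \<in> hyp_box ((1 - t (Suc k)) * R) (M k) j"
      using cells[OF k j(1)] by blast
    obtain u \<xi> where z_eq: "z = (u, \<xi>)" by (cases z)
    have u: "0 \<le> u" "u \<le> (1 - t (Suc k)) * R" "\<xi> \<in> circle_arc (M k) j"
      using z(2) by (auto simp: z_eq hyp_box_def)
    have "\<bar>\<psi> - \<xi>\<bar> \<le> exp ((t k + t (Suc k) - 1) * R / 2)"
      using same_arc[OF j(2) u(3)] M(2)[OF k] by linarith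
    then have "hyp_dist y z \<le> R"
      unfolding y_eq z_eq
      using s u y(2) t[of k] t[of "Suc k"] Suc.prems R big
      by (intro hyp_dist_near[of s "t k" R u "t (Suc k)" \<delta>]) (auto simp: y_eq)
    \<comment> \<open>The point found may be \<open>y\<close> itself, if \<open>y\<close> is already
      deep enough.\<close>
    then have "z = y \<or> z \<in> nbrs X (hrg_adj n C) y"
      using z(1) by (auto simp: nbrs_def hrg_adj_def R_def)
    then have "z \<in> hops X (hrg_adj n C) 1 y"
      using hops_1 self_in_hops by metis
    then have "z \<in> hops X (hrg_adj n C) (Suc k) x"
      using hops_trans[OF y(3)] by fastforce
    then show ?case using z(1) u(2) by (intro bexI[of _ z]) (simp_all add: z_eq del: hops.simps)
  qed
  then show ?thesis by blast
qed

text \<open>Two descents of \<open>L\<close> hops, the second one reversed, are joined by at most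
  one edge of the core clique.\<close>

lemma hops_core:
  assumes X: "X \<subseteq> hyp_disk (hrg_radius n C)" and uv: "u \<in> X" "v \<in> X"
    and near: "\<And>w. w \<in> {u, v} \<Longrightarrow> \<exists>y\<in>X. fst y \<le> hrg_radius n C / 2 \<and> y \<in> hops X (hrg_adj n C) L w"
  shows "v \<in> hops X (hrg_adj n C) (2 * L + 1) u"
proof -
  let ?E = "hrg_adj n C"
  obtain y z where y: "y \<in> X" "fst y \<le> hrg_radius n C / 2" "y \<in> hops X ?E L u"
    and z: "z \<in> X" "fst z \<le> hrg_radius n C / 2" "z \<in> hops X ?E L v"
    using near by blast
  have "z = y \<or> z \<in> nbrs X ?E y"
    using hrg_core_clique[OF X y(1) z(1) _ y(2) z(2)] z(1) by (auto simp: nbrs_def)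
  then have "z \<in> hops X ?E 1 y" using hops_1 self_in_hops by metis
  then have "z \<in> hops X ?E (L + 1) u" using hops_trans[OF y(3)] by blast
  moreover have "v \<in> hops X ?E L z"
    using hops_sym[of ?E v X z L] hrg_adj_commute[of n C] uv(2) z(3) by blast
  ultimately have "v \<in> hops X ?E (L + 1 + L) u" by (rule hops_trans)
  then show ?thesis by (simp add: mult_2 add.commute add.left_commute)
qed

section \<open>Exponential estimates on the scale of R\<close>

lemma eventually_exp_le:
  fixes A b g h :: real
  assumes "g < h" "0 < b"
  shows "\<forall>\<^sub>F x in at_top. A * exp (g * x) \<le> b * exp (h * x)"
proof -
  have "filterlim (\<lambda>x. b * exp ((h - g) * x)) at_top at_top"
    using assms by (intro filterlim_tendsto_pos_mult_at_top[OF tendsto_const]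
      filterlim_compose[OF exp_at_top] filterlim_ident) auto
  then have "\<forall>\<^sub>F x in at_top. A \<le> b * exp ((h - g) * x)"
    by (simp add: filterlim_at_top)
  then show ?thesis
  proof eventually_elim
    case (elim x)
    then have "A * exp (g * x) \<le> b * exp ((h - g) * x) * exp (g * x)"
      by (intro mult_right_mono) auto
    also have "\<dots> = b * exp (h * x)" by (simp add: algebra_simps flip: exp_add)
    finally show ?case .
  qed
qed

lemma cosh_minus_one_le: "cosh x - 1 \<le> exp x" if "0 \<le> x" for x :: real
  using cosh_le_exp_abs[of x] that by simp

text \<open>For \<open>2 \<le> x\<close> one has \<open>4 \<le> exp x\<close>, so subtracting 1
  costs at most half of \<open>exp x / 2\<close>.\<close>

lemma cosh_minus_one_ge:
  assumes "2 \<le> x"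
  shows "exp x / 4 \<le> cosh x - (1 :: real)"
proof -
  have "1 + 2 / 2 \<le> exp (2 / 2 :: real)" by (rule exp_ge_add_one_self)
  then have "2\<^sup>2 \<le> (exp (1 :: real))\<^sup>2" by (intro power_mono) auto
  also have "\<dots> = exp 2" by (simp flip: exp_double)
  also have "\<dots> \<le> exp x" using assms by simp
  finally show ?thesis using cosh_ge_half_exp[of x] by simp
qed

lemma cosh_ratio_ge:
  assumes "2 \<le> x" "x \<le> y"
  shows "exp (x - y) / 4 \<le> (cosh x - 1) / (cosh y - (1 :: real))"
proof -
  have "0 < cosh y - 1" using cosh_real_nonneg_less_iff[of 0 y] assms by simp
  then have "exp x / 4 / exp y \<le> (cosh x - 1) / (cosh y - 1)"
    using assms cosh_real_ge_1[of x]
    by (intro frac_le cosh_minus_one_ge cosh_minus_one_le) auto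
  then show ?thesis by (simp add: exp_diff)
qed

lemma cosh_ratio_le:
  assumes "0 \<le> x" "2 \<le> y"
  shows "(cosh x - 1) / (cosh y - 1) \<le> 4 * exp (x - y :: real)"
proof -
  have "(cosh x - 1) / (cosh y - 1) \<le> exp x / (exp y / 4)"
    using assms by (intro frac_le cosh_minus_one_ge cosh_minus_one_le) auto
  then show ?thesis by (simp add: exp_diff mult.commute)
qed

lemma hrg_radius_at_top: "filterlim (\<lambda>n. hrg_radius n C) at_top sequentially"
  unfolding hrg_radius_def by real_asymp

text \<open>Powers of \<open>n\<close> become powers of \<open>exp R\<close> with half the exponent;
  this puts all comparisons on one scale.\<close>

lemma of_nat_eq_exp_hrg_radius:
  assumes "1 \<le> n"
  shows "real n = exp (- C / 2) * exp (hrg_radius n C / 2)"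
proof -
  have "- C / 2 + hrg_radius n C / 2 = ln (real n)"
    by (simp add: hrg_radius_def field_simps)
  then show ?thesis using assms by (simp flip: exp_add)
qed

section \<open>The colouring of a typical graph\<close>

locale hrg_colouring =
  fixes \<alpha> C :: real and c :: nat
  assumes \<alpha>: "1 / 2 < \<alpha>" "\<alpha> < 1"
begin

text \<open>The exponents below refer to powers of \<^term>\<open>exp (R n)\<close>.  The core has about
  \<open>exp (2 \<eta> R)\<close> vertices; the fresh palette has \<open>exp (3 \<mu> R)\<close> colours up to constants, fewer than
  \<open>exp (\<eta> R)\<close>; the degree threshold is of order \<open>exp (\<kappa> R)\<close>; vertices within \<open>\<delta> R\<close> of the boundary
  have degree below it.\<close>

definition "\<eta> = (1 - \<alpha>) / 4"
definition "\<mu> = \<eta> / 4"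
definition "\<kappa> = \<mu> / 2"
definition "\<delta> = \<kappa> / 2"
text \<open>The margin of the depth recursion: boxes on the way to the core have mean of order at
  least \<open>exp (\<zeta> / 2 * R n)\<close>.\<close>

definition "\<zeta> = \<delta> * (1 / \<alpha> - 1)"
text \<open>Governs the failure probability exp (- exp (\<gamma> R)) per box; it lies below the
  exponents \<kappa>, \<zeta> / 2 and 2 \<eta> available in the tails.\<close>

definition "\<gamma> = \<zeta> / 4"
text \<open>Enough layers for the loss exp (R / (2 K)) across a layer to be at most exp (\<kappa> R
  / 4).\<close>

definition "K = nat \<lceil>2 / \<kappa>\<rceil>"
text \<open>Large enough for \<open>c / 2 < a * \<mu>\<close>, so that
  \<open>positions n ^ a\<close> eventually exceeds the number \<open>n ^ c\<close> of IDs.\<close>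

definition "a = nat \<lceil>c / \<mu>\<rceil> + 1"
text \<open>From distance \<open>t R\<close> to the boundary, a box of neighbours at distance at least \<open>t' R\<close> has mean of
  order \<open>exp ((t - (2 \<alpha> - 1) t') R / 2)\<close>, which is large for \<open>t' = t / \<alpha>\<close> since \<open>2 \<alpha> - 1 < \<alpha>\<close>.\<close>

definition "depth k = min (1 / 2) (\<delta> / \<alpha> ^ k)"
text \<open>After this many steps the uncapped depth exceeds 1 / 2, that is, the core is
  reached.\<close>

definition "L = (SOME L. \<alpha> ^ L < 2 * \<delta>)"

definition "R n = hrg_radius n C"
definition "positions n = nat \<lceil>exp (\<mu> * R n)\<rceil>"
definition "core_size n = nat \<lfloor>exp (\<eta> * R n)\<rfloor>"
definition "cell_size n = nat \<lceil>exp (\<kappa> * R n)\<rceil>"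
definition "threshold n = 5 * K * cell_size n + 1"
definition "fine_count n k = nat \<lceil>2 * pi / exp ((depth k + depth (Suc k) - 1) * R n / 2)\<rceil>"
definition "arc_width n i = 10 * exp ((\<delta> - (real i - 1) / K) * R n / 2)"
definition "coarse_count n i = max 1 (nat \<lfloor>2 * pi / arc_width n i\<rfloor>)"
definition "code n = (SOME code :: nat \<Rightarrow> nat \<Rightarrow> nat.
   (\<forall>i<n ^ c. \<forall>p<positions n. code i p < (positions n)\<^sup>2) \<and>
   (\<forall>i<n ^ c. \<forall>j<n ^ c. i \<noteq> j \<longrightarrow> card {p. p < positions n \<and> code i p = code j p} < a))"
definition "algorithm n = colouring_algorithm (threshold n) (positions n) ((positions n)\<^sup>2) (code n)"
definition "excess n = (real (positions n)) ^ 3 / exp (\<eta> * R n)"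

definition "core n = hyp_box (R n / 2) 1 0"
definition "fine_box n k j = hyp_box ((1 - depth (Suc k)) * R n) (fine_count n k) j"
definition "coarse_box n i j = hyp_box (i * R n / K) (coarse_count n i) j"

text \<open>All randomness is confined to this condition on counts; colouring a typical point set is
  then a deterministic statement.\<close>

definition "typical n X \<longleftrightarrow> core_size n < card (X \<inter> core n) \<and>
   (\<forall>k<L. \<forall>j<fine_count n k. 0 < card (X \<inter> fine_box n k j)) \<and>
   (\<forall>i\<in>{1..K}. \<forall>j<coarse_count n i. card (X \<inter> coarse_box n i j) < cell_size n)"

text \<open>The bound 8 gives \<open>2 \<le> \<alpha> * \<rho>\<close> for all radii
  \<open>\<rho>\<close> from \<open>R n / 2\<close> on, as the estimates of
  \<open>cosh x - 1\<close> require.\<close>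

definition "large n \<longleftrightarrow> 1 \<le> n \<and> 8 \<le> R n \<and> 1 \<le> R n / K \<and> 4 * exp ((1 - \<delta>) * R n) \<le> exp (R n)
   \<and> a * threshold n \<le> positions n \<and> n ^ c < positions n ^ a"

lemma largeD:
  assumes "large n"
  shows "1 \<le> n" "8 \<le> R n" "1 \<le> R n / K" "4 * exp ((1 - \<delta>) * R n) \<le> exp (R n)"
    "a * threshold n \<le> positions n" "n ^ c < positions n ^ a"
  using assms unfolding large_def by blast+

lemma params: "0 < \<eta>" "0 < \<mu>" "0 < \<kappa>" "0 < \<delta>" "\<delta> < 1 / 2" "0 < \<zeta>" "0 < \<gamma>" "0 < K"
  "1 / (2 * K) \<le> \<kappa> / 4" "0 < a" "\<gamma> < \<kappa>" "\<gamma> < \<zeta> / 2" "\<gamma> < 2 * \<eta>" "\<eta> < 2 * \<eta>" "\<kappa> < \<mu>"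
proof -
  show pos: "0 < \<eta>" "0 < \<mu>" "0 < \<kappa>" "0 < \<delta>" "0 < a" "\<eta> < 2 * \<eta>" "\<kappa> < \<mu>"
    using \<alpha> by (auto simp: \<eta>_def \<mu>_def \<kappa>_def \<delta>_def a_def)
  have "0 < 1 / \<alpha> - 1" using \<alpha> by (simp add: field_simps)
  then show \<zeta>: "0 < \<zeta>" using pos by (simp add: \<zeta>_def)
  then show "0 < \<gamma>" "\<gamma> < \<zeta> / 2" by (auto simp: \<gamma>_def)
  show "\<delta> < 1 / 2" using \<alpha> by (simp add: \<eta>_def \<mu>_def \<kappa>_def \<delta>_def)
  have "2 / \<kappa> \<le> K" by (simp add: K_def of_nat_ceiling)
  moreover have "0 < 2 / \<kappa>" using pos by simp
  ultimately show K: "0 < K" by (cases K) auto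
  then show "1 / (2 * K) \<le> \<kappa> / 4" using \<open>2 / \<kappa> \<le> K\<close> pos by (simp add: field_simps)
  have "1 / \<alpha> - 1 < 1" using \<alpha> by (simp add: field_simps)
  then have "\<zeta> \<le> \<delta> * 1" unfolding \<zeta>_def using pos by (intro mult_left_mono) auto
  then show "\<gamma> < \<kappa>" using pos by (simp add: \<gamma>_def \<delta>_def)
  also have "\<kappa> < 2 * \<eta>" using pos(1) by (simp add: \<kappa>_def \<mu>_def)
  finally show "\<gamma> < 2 * \<eta>" .
qed

lemma depth: "\<delta> \<le> depth k" "depth k \<le> 1 / 2" "depth 0 = \<delta>" "depth L = 1 / 2"
  "\<zeta> \<le> depth k - (2 * \<alpha> - 1) * depth (Suc k)"
proof -
  have "\<alpha> ^ k \<le> 1" using \<alpha> by (intro power_le_one) auto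
  then have "\<delta> * \<alpha> ^ k \<le> \<delta> * 1" using params(4) by (intro mult_left_mono) auto
  then have "\<delta> \<le> \<delta> / \<alpha> ^ k" using \<alpha> by (simp add: field_simps)
  then show d: "\<delta> \<le> depth k" using params(5) by (simp add: depth_def)
  show "depth k \<le> 1 / 2" unfolding depth_def by (rule min.cobounded1)
  show "depth 0 = \<delta>" using params(5) by (simp add: depth_def)
  have "\<exists>L. \<alpha> ^ L < 2 * \<delta>"
    using params(4) \<alpha> by (intro real_arch_pow_inv) auto
  then have "\<alpha> ^ L < 2 * \<delta>" unfolding L_def by (rule someI_ex)
  then have "1 / 2 \<le> \<delta> / \<alpha> ^ L" using \<alpha> by (simp add: field_simps)
  then show "depth L = 1 / 2" by (simp add: depth_def)
  \<comment> \<open>Capping at 1 / 2 preserves growth by at most 1 / \<alpha>, since dividing the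
    cap by \<alpha> only increases it.\<close>
  have "depth (Suc k) \<le> depth k / \<alpha>"
  proof -
    define x where "x = \<delta> / \<alpha> ^ k"
    have *: "depth (Suc k) = min (1 / 2) (x / \<alpha>)" "depth k = min (1 / 2) x"
      by (simp_all add: depth_def x_def mult.commute)
    have half: "1 / 2 \<le> 1 / 2 / \<alpha>" using \<alpha> by (simp add: field_simps)
    show ?thesis
    proof (cases "1 / 2 \<le> x")
      case True
      then show ?thesis
        using half min.cobounded1[of "1 / 2" "x / \<alpha>"] unfolding * by simp
    next
      case False
      then show ?thesis
        using min.cobounded2[of "1 / 2" "x / \<alpha>"] unfolding * by simp
    qed
  qed
  then have "(2 * \<alpha> - 1) * depth (Suc k) \<le> (2 * \<alpha> - 1) * (depth k / \<alpha>)"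
    using \<alpha> by (intro mult_left_mono) auto
  then have "depth k * (1 / \<alpha> - 1) \<le> depth k - (2 * \<alpha> - 1) * depth (Suc k)"
  proof -
    have "(2 * \<alpha> - 1) * (depth k / \<alpha>) = depth k * ((2 * \<alpha> - 1) / \<alpha>)" by simp
    also have "(2 * \<alpha> - 1) / \<alpha> = 2 - 1 / \<alpha>" using \<alpha> by (simp add: field_simps)
    finally show ?thesis using \<open>(2 * \<alpha> - 1) * depth (Suc k) \<le> (2 * \<alpha> - 1) * (depth k / \<alpha>)\<close>
      by (simp add: algebra_simps)
  qed
  moreover have "\<zeta> \<le> depth k * (1 / \<alpha> - 1)"
    unfolding \<zeta>_def using \<alpha> d by (intro mult_right_mono) (simp_all add: le_divide_eq)
  ultimately show "\<zeta> \<le> depth k - (2 * \<alpha> - 1) * depth (Suc k)" by linarith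
qed

lemma fine_count:
  assumes "large n"
  shows "0 < fine_count n k" "2 * pi / fine_count n k \<le> exp ((depth k + depth (Suc k) - 1) * R n / 2)"
    "fine_count n k \<le> 4 * pi / exp ((depth k + depth (Suc k) - 1) * R n / 2)"
proof -
  have "(depth k + depth (Suc k) - 1) * R n / 2 \<le> 0"
    using depth(2)[of k] depth(2)[of "Suc k"] largeD(2)[OF assms]
    by (intro divide_nonpos_nonneg mult_nonpos_nonneg) auto
  then have "exp ((depth k + depth (Suc k) - 1) * R n / 2) \<le> 1" by simp
  note arcs = fine_arcs[OF exp_gt_zero this fine_count_def]
  show "0 < fine_count n k" "2 * pi / fine_count n k \<le> exp ((depth k + depth (Suc k) - 1) * R n / 2)"
    "fine_count n k \<le> 4 * pi / exp ((depth k + depth (Suc k) - 1) * R n / 2)" by (rule arcs)+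
qed

lemma coarse_count: "0 < coarse_count n i" "coarse_count n i = 1 \<or> arc_width n i \<le> 2 * pi / coarse_count n i"
    "1 / coarse_count n i \<le> arc_width n i / pi" "coarse_count n i \<le> 1 + 2 * pi / arc_width n i"
proof -
  have "0 < arc_width n i" by (simp add: arc_width_def)
  note arcs = coarse_arcs[OF this coarse_count_def]
  show "0 < coarse_count n i" "coarse_count n i = 1 \<or> arc_width n i \<le> 2 * pi / coarse_count n i"
    "1 / coarse_count n i \<le> arc_width n i / pi" "coarse_count n i \<le> 1 + 2 * pi / arc_width n i"
    by (rule arcs)+
qed

text \<open>Over \<open>(positions n)\<^sup>2\<close> symbols the counting condition of
  \<open>separating_code\<close> reduces to \<open>n ^ c < positions n ^ a\<close>.\<close>

lemma code:
  assumes "large n"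
  shows "i < n ^ c \<Longrightarrow> p < positions n \<Longrightarrow> code n i p < (positions n)\<^sup>2"
    "i < n ^ c \<Longrightarrow> j < n ^ c \<Longrightarrow> i \<noteq> j \<Longrightarrow>
       card {p. p < positions n \<and> code n i p = code n j p} < a"
proof -
  have "a \<le> a * threshold n" by (simp add: threshold_def)
  then have a: "a \<le> positions n" using largeD(5)[OF assms] by (rule order.trans)
  then have "0 < positions n" using params(10) by simp
  then have "n ^ c * positions n ^ a < positions n ^ a * positions n ^ a"
    using largeD(6)[OF assms] by (intro mult_strict_right_mono) auto
  also have "\<dots> = ((positions n)\<^sup>2) ^ a" by (simp add: power2_eq_square power_mult_distrib)
  finally have "\<exists>code :: nat \<Rightarrow> nat \<Rightarrow> nat.
     (\<forall>i<n ^ c. \<forall>p<positions n. code i p < (positions n)\<^sup>2) \<and>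
     (\<forall>i<n ^ c. \<forall>j<n ^ c. i \<noteq> j \<longrightarrow> card {p. p < positions n \<and> code i p = code j p} < a)"
    by (rule separating_code[OF _ a])
  from someI_ex[OF this, folded code_def]
  show "i < n ^ c \<Longrightarrow> p < positions n \<Longrightarrow> code n i p < (positions n)\<^sup>2"
    "i < n ^ c \<Longrightarrow> j < n ^ c \<Longrightarrow> i \<noteq> j \<Longrightarrow>
       card {p. p < positions n \<and> code n i p = code n j p} < a" by auto
qed

text \<open>The rounds are the \<open>2 * L + 1\<close> hops between high-degree vertices and the
  first round, which only delivers IDs. The core turns the additive cost of the fresh palette into
  the factor \<open>1 + excess n\<close>.\<close>

lemma locally_colours_typical:
  assumes n: "large n" and X: "finite X" "X \<subseteq> hyp_disk (R n)" "typical n X"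
  shows "locally_colours (algorithm n) (2 * L + 2) (n ^ c) (1 + excess n) X (hrg_adj n C)"
proof -
  let ?E = "hrg_adj n C" and ?q = "(positions n)\<^sup>2"
  have R: "0 \<le> R n" using largeD(2)[OF n] by simp
  have R1: "1 \<le> (1 - \<delta>) * R n"
  proof -
    have "1 / 2 * 8 \<le> (1 - \<delta>) * R n"
      using largeD(2)[OF n] params(5) by (intro mult_mono) auto
    then show ?thesis by simp
  qed
  have core: "exp (\<eta> * R n) \<le> chromatic_number X ?E"
  proof -
    have "card (X \<inter> core n) \<le> chromatic_number X ?E"
    proof (rule clique_le_chromatic_number[OF X(1)])
      show "\<not> ?E x x" for x by (simp add: hrg_adj_def)
      show "?E x y" if "x \<in> X \<inter> core n" "y \<in> X \<inter> core n" "x \<noteq> y" for x y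
        using that X(2) by (intro hrg_core_clique[of X]) (auto simp: core_def hyp_box_def R_def)
    qed simp
    \<comment> \<open>The strict inequality in \<open>typical\<close> makes up for the floor in
      \<open>core_size\<close>.\<close>
    moreover have "exp (\<eta> * R n) < real (core_size n) + 1"
      unfolding core_size_def by (simp add: of_nat_floor)
    moreover have "core_size n + 1 \<le> card (X \<inter> core n)" using X(3) by (simp add: typical_def)
    ultimately show ?thesis by linarith
  qed
  have inner: "fst x \<le> (1 - \<delta>) * R n" if x: "x \<in> X" "threshold n \<le> card (nbrs X ?E x)" for x
  proof (rule ccontr)
    assume "\<not> ?thesis"
    then have far: "(1 - \<delta>) * hrg_radius n C < fst x" by (simp add: R_def)
    have "card (nbrs X ?E x) \<le> 5 * K * cell_size n"
    proof (rule card_nbrs_far_le[OF X(1) X(2)[unfolded R_def] x(1) far])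
      show "1 \<le> (1 - \<delta>) * hrg_radius n C" using R1 by (simp add: R_def)
      show "1 \<le> hrg_radius n C / K" using largeD(3)[OF n] by (simp only: R_def)
      show "0 < K" "0 \<le> \<delta>" using params(4,8) by auto
      show "0 < coarse_count n i" for i by (rule coarse_count)
      show "coarse_count n i = 1 \<or>
          10 * exp ((\<delta> - (real i - 1) / K) * hrg_radius n C / 2) \<le> 2 * pi / coarse_count n i" for i
        using coarse_count(2)[of n i] by (simp only: arc_width_def R_def)
      show "card (X \<inter> hyp_box (i * hrg_radius n C / K) (coarse_count n i) j) \<le> cell_size n"
        if "i \<in> {1..K}" "j < coarse_count n i" for i j
        using X(3) that by (simp add: typical_def coarse_box_def R_def less_imp_le)
    qed
    then show False using x(2) by (simp add: threshold_def)
  qed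
  have near: "v \<in> hops X ?E (2 * L + 1) u"
    if "u \<in> X" "v \<in> X" "threshold n \<le> card (nbrs X ?E u)" "threshold n \<le> card (nbrs X ?E v)" for u v
  proof (rule hops_core)
    fix w assume "w \<in> {u, v}"
    then have w: "w \<in> X" "fst w \<le> (1 - depth 0) * R n" 
      using that inner[OF that(1,3)] inner[OF that(2,4)] by (auto simp: depth(3))
    have "\<exists>y\<in>X. fst y \<le> (1 - depth L) * hrg_radius n C \<and> y \<in> hops X ?E L w"
    proof (rule near_core_hops[OF X(2)[unfolded R_def] R[unfolded R_def] depth(1)])
      show "0 < fine_count n k" "2 * pi / fine_count n k
          \<le> exp ((depth k + depth (Suc k) - 1) * hrg_radius n C / 2)" for k
        using fine_count[OF n, of k] by (auto simp: R_def)
      show "X \<inter> hyp_box ((1 - depth (Suc k)) * hrg_radius n C) (fine_count n k) j \<noteq> {}"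
        if "k < L" "j < fine_count n k" for k j
      proof -
        have "0 < card (X \<inter> fine_box n k j)" using X(3) that by (simp add: typical_def)
        then show ?thesis by (auto simp: fine_box_def R_def card_gt_0_iff)
      qed
      show "4 * exp ((1 - \<delta>) * hrg_radius n C) \<le> exp (hrg_radius n C)"
        using largeD(4)[OF n] by (simp only: R_def)
    qed (use w in \<open>auto simp: R_def\<close>)
    then show "\<exists>y\<in>X. fst y \<le> hrg_radius n C / 2 \<and> y \<in> hops X ?E L w"
      by (simp add: depth(4) R_def)
  qed (use X that in \<open>auto simp: R_def\<close>)
  show ?thesis
    unfolding locally_colours_def
  proof (intro allI impI)
    fix ident port assume ids: "valid_ids (n ^ c) X ident \<and> port_numbering X ?E port"
    have "proper_colouring X ?E (positions n * ?q + chromatic_number X ?E)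
        (local_output (algorithm n) (Suc (2 * L + 1)) X ?E ident port)"
      unfolding algorithm_def
    proof (intro proper_colouring_colouring_algorithm
        [OF X(1) _ _ near, where a = a and N = "n ^ c"])
      show "\<not> ?E v v" for v by (simp add: hrg_adj_def)
      show "?E v u" if "?E u v" for u v using that hrg_adj_commute by blast
      show "1 \<le> threshold n" by (simp add: threshold_def)
      show "0 < a" by (rule params)
      show "a * threshold n \<le> positions n" using n by (rule largeD)
    qed (use code[OF n] ids in auto)
    moreover have "real (positions n * ?q + chromatic_number X ?E)
        \<le> (1 + excess n) * real (chromatic_number X ?E)"
    proof -
      have "real (positions n * ?q) = excess n * exp (\<eta> * R n)"
        by (simp add: excess_def power2_eq_square power3_eq_cube)
      also have "\<dots> \<le> excess n * chromatic_number X ?E"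
        using core by (intro mult_left_mono) (auto simp: excess_def)
      finally show ?thesis by (simp add: algebra_simps)
    qed
    ultimately show "\<exists>k. real k \<le> (1 + excess n) * real (chromatic_number X ?E) \<and>
        proper_colouring X ?E k (local_output (algorithm n) (2 * L + 2) X ?E ident port)"
      by (intro exI[of _ "positions n * ?q + chromatic_number X ?E"]) simp
  qed
qed

section \<open>Asymptotics\<close>

lemma R_at_top: "filterlim R at_top sequentially"
  unfolding R_def[abs_def] by (rule hrg_radius_at_top)

lemma eventually_R_ge: "\<forall>\<^sub>F n in sequentially. b \<le> R n"
  using R_at_top by (simp add: filterlim_at_top)

lemma eventually_exp_R_le:
  assumes "g < h" "0 < b"
  shows "\<forall>\<^sub>F n in sequentially. A * exp (g * R n) \<le> b * exp (h * R n)"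
  using eventually_compose_filterlim[OF eventually_exp_le[OF assms] R_at_top] .

lemma of_nat_eq: "1 \<le> n \<Longrightarrow> real n = exp (- C / 2) * exp (R n / 2)"
  unfolding R_def by (rule of_nat_eq_exp_hrg_radius)

lemma positions_ge: "exp (\<mu> * R n) \<le> positions n"
  by (simp add: positions_def of_nat_ceiling)

lemma nat_ceiling_exp_le: "0 \<le> x \<Longrightarrow> real (nat \<lceil>exp x\<rceil>) \<le> 2 * exp x"
proof -
  assume "0 \<le> x"
  then have "1 \<le> exp x" by simp
  moreover have "real (nat \<lceil>exp x\<rceil>) \<le> exp x + 1" by (simp add: of_nat_nat)
  ultimately show ?thesis by linarith
qed

lemma eventually_large: "eventually large sequentially"
proof -
  have "c / \<mu> \<le> real a - 1" by (simp add: a_def of_nat_ceiling)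
  then have "c + \<mu> \<le> a * \<mu>" using params(2) by (simp add: field_simps)
  then have ac: "real c / 2 < a * \<mu>" using params(2) by (smt (verit) of_nat_0_le_iff field_sum_of_halves)
  have 4: "1 - \<delta> < 1" using params(4) by simp
  show ?thesis
    using eventually_ge_at_top[of 1] eventually_R_ge[of 8] eventually_R_ge[of K]
      eventually_exp_R_le[OF 4 zero_less_one, of 4]
      eventually_exp_R_le[OF params(15) zero_less_one, of "a * (10 * K + 1)"]
      eventually_exp_R_le[OF ac half_gt_zero_iff[THEN iffD2, OF zero_less_one],
        of "exp (- C / 2 * c)"]
  proof (eventually_elim)
    case (elim n)
    have e1: "1 \<le> exp (\<kappa> * R n)" using elim(2) params(3) by simp
    have "real (threshold n) \<le> 5 * K * (2 * exp (\<kappa> * R n)) + exp (\<kappa> * R n)"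
    proof -
      have "real (cell_size n) \<le> 2 * exp (\<kappa> * R n)"
        unfolding cell_size_def using elim(2) params(3) by (intro nat_ceiling_exp_le) simp
      then have "5 * K * real (cell_size n) \<le> 5 * K * (2 * exp (\<kappa> * R n))"
        by (intro mult_left_mono) auto
      moreover have "real (threshold n) = 5 * K * real (cell_size n) + 1"
        by (simp add: threshold_def)
      ultimately show ?thesis using e1 by linarith
    qed
    then have "a * real (threshold n) \<le> a * (5 * K * (2 * exp (\<kappa> * R n)) + exp (\<kappa> * R n))"
      by (intro mult_left_mono) auto
    also have "\<dots> = a * (10 * K + 1) * exp (\<kappa> * R n)" by (simp add: algebra_simps)
    also have "\<dots> \<le> positions n" using elim(5) positions_ge[of n] by simp
    finally have "real (a * threshold n) \<le> real (positions n)" by simp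
    then have thr: "a * threshold n \<le> positions n" by (simp only: of_nat_le_iff)
    have "real (n ^ c) = exp (- C / 2) ^ c * exp (R n / 2) ^ c"
      using of_nat_eq[OF elim(1)] by (simp add: power_mult_distrib)
    also have "\<dots> = exp (- C / 2 * c) * exp (c / 2 * R n)"
      unfolding exp_of_nat_mult[symmetric] by (simp add: mult.commute)
    also have "\<dots> \<le> 1 / 2 * exp (a * \<mu> * R n)" by (rule elim)
    also have "\<dots> < exp (a * \<mu> * R n)" by simp
    also have "exp (a * \<mu> * R n) = exp (\<mu> * R n) ^ a"
      unfolding exp_of_nat_mult[symmetric] by (simp add: mult.assoc)
    also have "\<dots> \<le> real (positions n) ^ a" by (intro power_mono positions_ge) simp
    finally have "real (n ^ c) < real (positions n ^ a)" by simp
    then have pow: "n ^ c < positions n ^ a" by (simp only: of_nat_less_iff)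
    show ?case
      unfolding large_def using elim(1-4) thr pow params(8) by simp
  qed
qed

text \<open>The palette has order exp (3 \<mu> R), and \<eta> = 4 \<mu> leaves a factor exp (- \<mu>
  R).\<close>

lemma excess_tendsto: "excess \<longlonglongrightarrow> 0"
proof (rule tendsto_sandwich)
  show "\<forall>\<^sub>F n in sequentially. 0 \<le> excess n" by (simp add: excess_def)
  show "\<forall>\<^sub>F n in sequentially. excess n \<le> 8 * exp (- \<mu> * R n)"
    using eventually_R_ge[of 0]
  proof eventually_elim
    case (elim n)
    have "real (positions n) ^ 3 \<le> (2 * exp (\<mu> * R n)) ^ 3"
      unfolding positions_def using elim params(2) 
      by (intro power_mono nat_ceiling_exp_le of_nat_0_le_iff mult_nonneg_nonneg) auto
    also have "\<dots> = 8 * exp (3 * (\<mu> * R n))"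
      using exp_of_nat_mult[of 3 "\<mu> * R n"] by (simp add: power_mult_distrib)
    finally have "excess n \<le> 8 * exp (3 * (\<mu> * R n)) / exp (\<eta> * R n)"
      unfolding excess_def by (intro divide_right_mono) auto
    also have "\<dots> = 8 * exp (3 * (\<mu> * R n) - \<eta> * R n)" by (simp add: exp_diff)
    also have "3 * (\<mu> * R n) - \<eta> * R n = - \<mu> * R n" by (simp add: \<mu>_def)
    finally show ?case .
  qed
  have "filterlim (\<lambda>n. \<mu> * R n) at_top sequentially"
    using params(2) by (intro filterlim_tendsto_pos_mult_at_top[OF tendsto_const _ R_at_top])
  then have "(\<lambda>n. exp (- (\<mu> * R n))) \<longlonglongrightarrow> 0"
    by (intro filterlim_compose[OF exp_at_bot]) (simp add: filterlim_uminus_at_bot)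
  from tendsto_mult[OF tendsto_const[of 8] this] show "(\<lambda>n. 8 * exp (- \<mu> * R n)) \<longlonglongrightarrow> 0"
    by simp
qed simp

section \<open>Means of the core, fine and coarse boxes\<close>

definition "mean_const = exp (- C / 2)"

text \<open>In the exponent, \<open>R n / 2\<close> stems from the factor \<open>n\<close> and the
  rest from the ratio of hyperbolic cosines.\<close>

lemma box_mean_ge:
  assumes n: "large n" and \<rho>: "R n / 2 \<le> \<rho>" "\<rho> \<le> R n" and j: "j < M" and M: "real M \<le> b"
  shows "mean_const / (4 * b) * exp (R n / 2 + \<alpha> * (\<rho> - R n))
     \<le> measure (hrg_intensity n \<alpha> C) (hyp_box \<rho> M j)"
proof -
  have R: "8 \<le> R n" by (rule largeD(2)[OF n])
  have "2 \<le> 1 / 2 * (R n / 2)" using R by simp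
  also have "\<dots> \<le> \<alpha> * \<rho>" using \<alpha> \<rho> R by (intro mult_mono) auto
  finally have 2: "2 \<le> \<alpha> * \<rho>" .
  have "real n / b * (exp (\<alpha> * \<rho> - \<alpha> * R n) / 4)
      \<le> n / M * ((cosh (\<alpha> * \<rho>) - 1) / (cosh (\<alpha> * R n) - 1))"
    using j M 2 \<rho> \<alpha> by (intro mult_mono cosh_ratio_ge divide_left_mono) auto
  also have "\<dots> = measure (hrg_intensity n \<alpha> C) (hyp_box \<rho> M j)"
    using measure_hyp_box(2)[of \<alpha> \<rho> n C j M] \<alpha> \<rho> R j by (simp add: R_def)
  also have "real n / b * (exp (\<alpha> * \<rho> - \<alpha> * R n) / 4) =
      mean_const / (4 * b) * (exp (R n / 2) * exp (\<alpha> * \<rho> - \<alpha> * R n))"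
    using of_nat_eq[OF largeD(1)[OF n]] by (simp add: mean_const_def)
  also have "\<dots> = mean_const / (4 * b) * exp (R n / 2 + \<alpha> * (\<rho> - R n))"
    by (simp add: exp_add right_diff_distrib)
  finally show ?thesis .
qed

lemma box_mean_le:
  assumes n: "large n" and \<rho>: "0 \<le> \<rho>" "\<rho> \<le> R n" and j: "j < M" and M: "1 / real M \<le> b"
  shows "measure (hrg_intensity n \<alpha> C) (hyp_box \<rho> M j)
     \<le> 4 * mean_const * b * exp (R n / 2 + \<alpha> * (\<rho> - R n))"
proof -
  have R: "8 \<le> R n" by (rule largeD(2)[OF n])
  have "1 / 2 * 8 \<le> \<alpha> * R n" using \<alpha> R by (intro mult_mono) auto
  then have 2: "2 \<le> \<alpha> * R n" by simp
  have "measure (hrg_intensity n \<alpha> C) (hyp_box \<rho> M j)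
      = n * (1 / M) * ((cosh (\<alpha> * \<rho>) - 1) / (cosh (\<alpha> * R n) - 1))"
    using measure_hyp_box(2)[of \<alpha> \<rho> n C j M] \<alpha> \<rho> R j by (simp add: R_def)
  also have "\<dots> \<le> n * b * (4 * exp (\<alpha> * \<rho> - \<alpha> * R n))"
    using M 2 \<rho> \<alpha> cosh_real_ge_1[of "\<alpha> * \<rho>"] cosh_real_ge_1[of "\<alpha> * R n"]
      order.trans[OF _ M, of 0]
    by (intro mult_mono cosh_ratio_le) auto
  also have "\<dots> = 4 * mean_const * b * (exp (R n / 2) * exp (\<alpha> * \<rho> - \<alpha> * R n))"
    using of_nat_eq[OF largeD(1)[OF n]] by (simp add: mean_const_def)
  also have "\<dots> = 4 * mean_const * b * exp (R n / 2 + \<alpha> * (\<rho> - R n))"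
    by (simp add: exp_add right_diff_distrib)
  finally show ?thesis .
qed

lemma box_sets:
  assumes "large n" "0 \<le> \<rho>" "\<rho> \<le> R n" "j < M"
  shows "hyp_box \<rho> M j \<in> sets (hrg_intensity n \<alpha> C)"
  using measure_hyp_box(1)[of \<alpha> \<rho> n C j M] assms largeD(2)[OF assms(1)] \<alpha> by (simp add: R_def)

lemma box_radii:
  assumes "large n"
  shows "0 \<le> R n / 2" "R n / 2 \<le> R n" "R n / 2 \<le> (1 - depth k) * R n" "(1 - depth k) * R n \<le> R n"
    "i \<in> {1..K} \<Longrightarrow> 0 \<le> real i * R n / K" "i \<in> {1..K} \<Longrightarrow> real i * R n / K \<le> R n"
proof -
  have R: "8 \<le> R n" by (rule largeD(2)[OF assms])
  show "0 \<le> R n / 2" "R n / 2 \<le> R n" using R by auto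
  have "1 / 2 * R n \<le> (1 - depth k) * R n"
    using R depth(2)[of k] by (intro mult_right_mono) auto
  then show "R n / 2 \<le> (1 - depth k) * R n" by simp
  have "0 \<le> depth k" using depth(1)[of k] params(4) by simp
  then show "(1 - depth k) * R n \<le> R n" using R by (simp add: left_diff_distrib)
  show "0 \<le> real i * R n / K" using R by simp
  assume "i \<in> {1..K}"
  then have "real i * R n \<le> real K * R n" using R by (intro mult_right_mono) auto
  then show "real i * R n / K \<le> R n" using params(8) by (simp add: field_simps)
qed

definition "core_const = mean_const / 4"
definition "fine_const = mean_const / (16 * pi)"
definition "coarse_const = 40 * mean_const / pi"

lemma core_mean_ge:
  assumes "large n"
  shows "core_const * exp (2 * \<eta> * R n) \<le> measure (hrg_intensity n \<alpha> C) (core n)"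
proof -
  have "R n / 2 + \<alpha> * (R n / 2 - R n) = 2 * \<eta> * R n" by (simp add: \<eta>_def field_simps)
  then show ?thesis
    using box_mean_ge[OF assms order.refl box_radii(2)[OF assms], of 0 1 1]
    by (simp add: core_def core_const_def)
qed

text \<open>With d and d' the depths at \<open>k\<close> and \<open>Suc k\<close>, arc width and
  radial factor contribute (d + d' - 1) R / 2 and R / 2 - \<alpha> d' R, in sum (d - (2 \<alpha> -
  1) d') R / 2.\<close>

lemma fine_mean_ge:
  assumes n: "large n" and j: "j < fine_count n k"
  shows "fine_const * exp (\<zeta> / 2 * R n) \<le> measure (hrg_intensity n \<alpha> C) (fine_box n k j)"
proof -
  define w where "w = exp ((depth k + depth (Suc k) - 1) * R n / 2)"
  have "\<zeta> * (R n / 2) \<le> (depth k - (2 * \<alpha> - 1) * depth (Suc k)) * (R n / 2)"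
    using depth(5) box_radii(1)[OF n] by (rule mult_right_mono)
  also have "\<dots> = (depth k + depth (Suc k) - 1) * R n / 2
      + (R n / 2 + \<alpha> * ((1 - depth (Suc k)) * R n - R n))"
    by (simp add: field_simps)
  finally have "fine_const * exp (\<zeta> / 2 * R n) \<le> fine_const *
      exp ((depth k + depth (Suc k) - 1) * R n / 2
      + (R n / 2 + \<alpha> * ((1 - depth (Suc k)) * R n - R n)))"
    by (intro mult_left_mono) (auto simp: fine_const_def mean_const_def)
  also have "\<dots> = mean_const / (4 * (4 * pi / w)) *
      exp (R n / 2 + \<alpha> * ((1 - depth (Suc k)) * R n - R n))"
    unfolding exp_add[of "(depth k + depth (Suc k) - 1) * R n / 2"] w_def[symmetric]
    by (simp add: fine_const_def)
  also have "\<dots> \<le> measure (hrg_intensity n \<alpha> C) (fine_box n k j)"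
    unfolding fine_box_def
    using fine_count(3)[OF n, of k] j by (intro box_mean_ge[OF n] box_radii[OF n]) (auto simp: w_def)
  finally show ?thesis .
qed

text \<open>Since \<alpha> > 1 / 2, the bound is largest for the outermost layer. There \<delta> / 2
  = \<kappa> / 4 and the layer loss of at most \<kappa> / 4 add up to at most \<kappa> / 2.\<close>

lemma coarse_mean_le:
  assumes n: "large n" and i: "i \<in> {1..K}" and j: "j < coarse_count n i"
  shows "measure (hrg_intensity n \<alpha> C) (coarse_box n i j) \<le> coarse_const * exp (\<kappa> / 2 * R n)"
proof -
  have R: "0 \<le> R n" using largeD(2)[OF n] by simp
  have "measure (hrg_intensity n \<alpha> C) (coarse_box n i j)
      \<le> 4 * mean_const * (arc_width n i / pi) * exp (R n / 2 + \<alpha> * (i * R n / K - R n))"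
    unfolding coarse_box_def
    by (intro box_mean_le[OF n] box_radii[OF n] i j coarse_count)
  also have "\<dots> = coarse_const * exp ((\<delta> - (real i - 1) / K) * R n / 2
      + (R n / 2 + \<alpha> * (i * R n / K - R n)))"
    unfolding exp_add[of "(\<delta> - (real i - 1) / K) * R n / 2"]
    by (simp add: coarse_const_def arc_width_def)
  also have "(\<delta> - (real i - 1) / K) * R n / 2 + (R n / 2 + \<alpha> * (i * R n / K - R n))
      = (\<delta> / 2 + 1 / (2 * K)) * R n - (\<alpha> - 1 / 2) * (R n - i * R n / K)"
    using params(8) by (simp add: field_simps)
  also have "coarse_const * exp \<dots> \<le> coarse_const * exp (\<kappa> / 2 * R n)"
  proof -
    have "0 \<le> (\<alpha> - 1 / 2) * (R n - i * R n / K)"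
      using \<alpha> box_radii(6)[OF n i] by simp
    moreover have "(\<delta> / 2 + 1 / (2 * K)) * R n \<le> \<kappa> / 2 * R n"
      using params(9) R by (intro mult_right_mono) (auto simp: \<delta>_def)
    ultimately show ?thesis
      by (intro mult_left_mono) (auto simp: coarse_const_def mean_const_def)
  qed
  finally show ?thesis .
qed

text \<open>\<open>exp (R n)\<close> is of order n^2, so the union bound runs over polynomially many
  boxes.\<close>

lemma counts_le:
  assumes n: "large n"
  shows "fine_count n k \<le> 16 * exp (R n)" 
    "i \<in> {1..K} \<Longrightarrow> coarse_count n i \<le> 2 * exp (R n)"
proof -
  have R: "8 \<le> R n" by (rule largeD(2)[OF n])
  have half: "exp (R n / 2) \<le> exp (R n)" using R by simp
  have "- (R n / 2) \<le> (depth k + depth (Suc k) - 1) * R n / 2"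
  proof -
    have "0 \<le> (depth k + depth (Suc k)) * R n"
      using depth(1)[of k] depth(1)[of "Suc k"] params(4) R by (intro mult_nonneg_nonneg) auto
    then show ?thesis by (simp add: left_diff_distrib)
  qed
  then have "4 * pi / exp ((depth k + depth (Suc k) - 1) * R n / 2) \<le> 4 * pi / exp (- (R n / 2))"
    by (intro divide_left_mono) auto
  also have "\<dots> = 4 * pi * exp (R n / 2)"
    by (simp only: exp_minus divide_inverse inverse_inverse_eq)
  also have "\<dots> \<le> 16 * exp (R n)" using pi_less_4 half by (intro mult_mono) auto
  finally show "fine_count n k \<le> 16 * exp (R n)" using fine_count(3)[OF n, of k] by linarith
  assume "i \<in> {1..K}"
  then have "(real i - 1) / K \<le> 1" by auto
  then have "- 1 * R n \<le> (\<delta> - (real i - 1) / K) * R n"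
    using params(4) R by (intro mult_right_mono) auto
  then have "10 * exp (- (R n / 2)) \<le> arc_width n i" by (simp add: arc_width_def)
  then have "2 * pi / arc_width n i \<le> 2 * pi / (10 * exp (- (R n / 2)))"
    by (intro divide_left_mono) (auto simp: arc_width_def)
  also have "\<dots> = pi / 5 * exp (R n / 2)"
    using exp_minus_inverse[of "R n / 2"] by (simp add: divide_eq_eq ac_simps)
  also have "\<dots> \<le> 1 * exp (R n)" using pi_less_4 half by (intro mult_mono) auto
  finally have "real (coarse_count n i) \<le> 1 + exp (R n)" using coarse_count(4)[of n i] by linarith
  moreover have "1 \<le> exp (R n)" using R by simp
  ultimately show "coarse_count n i \<le> 2 * exp (R n)" by linarith
qed

section \<open>Failure probabilities and the union bound\<close>

definition "error n = exp (- exp (\<gamma> * R n))"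

definition "tails_small n \<longleftrightarrow>
   exp (\<eta> * R n) - core_const / 2 * exp (2 * \<eta> * R n) \<le> - exp (\<gamma> * R n) \<and>
   - (fine_const / 2) * exp (\<zeta> / 2 * R n) \<le> - exp (\<gamma> * R n) \<and>
   coarse_const * exp (\<kappa> / 2 * R n) - exp (\<kappa> * R n) / 2 \<le> - exp (\<gamma> * R n)"

lemma eventually_tails_small: "eventually tails_small sequentially"
proof -
  have pos: "0 < core_const / 4" "0 < fine_const / 2" "(0 :: real) < 1 / 4"
    by (auto simp: core_const_def fine_const_def mean_const_def)
  have \<kappa>: "\<kappa> / 2 < \<kappa>" using params(3) by simp
  show ?thesis
    using eventually_exp_R_le[OF params(14) pos(1), of 1] eventually_exp_R_le[OF params(13) pos(1), of 1]
      eventually_exp_R_le[OF params(12) pos(2), of 1]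
      eventually_exp_R_le[OF \<kappa> pos(3), of coarse_const]
      eventually_exp_R_le[OF params(11) pos(3), of 1]
  proof eventually_elim
    case (elim n)
    then show ?case unfolding tails_small_def by linarith
  qed
qed

context
  fixes P :: "'w measure" and X :: "'w \<Rightarrow> (real \<times> real) set" and n :: nat
  assumes X: "poisson_point_process P (hrg_intensity n \<alpha> C) X"
    and n: "large n" "tails_small n"
begin

text \<open>The target size is of the order of the square root of the mean, so the factor
  \<open>2 ^ core_size n\<close> is negligible against the exponential decay in the mean.\<close>

lemma core_prob: "core n \<in> sets (hrg_intensity n \<alpha> C)"
  "measure P {\<omega>\<in>space P. card (X \<omega> \<inter> core n) \<le> core_size n} \<le> error n"
proof -
  show S: "core n \<in> sets (hrg_intensity n \<alpha> C)"
    unfolding core_def by (intro box_sets n box_radii) simp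
  have "(2::real) ^ core_size n \<le> exp 1 ^ core_size n"
    using exp_ge_add_one_self[of 1] by (intro power_mono) auto
  also have "\<dots> = exp (core_size n)" by (simp flip: exp_of_nat_mult)
  also have "\<dots> \<le> exp (exp (\<eta> * R n))" by (simp add: core_size_def of_nat_floor)
  finally have p: "(2::real) ^ core_size n \<le> exp (exp (\<eta> * R n))" .
  have "measure P {\<omega>\<in>space P. card (X \<omega> \<inter> core n) \<le> core_size n}
      \<le> 2 ^ core_size n * exp (- measure (hrg_intensity n \<alpha> C) (core n) / 2)"
    by (rule poisson_process_lower_tail[OF X S])
  also have "\<dots> \<le> exp (exp (\<eta> * R n)) * exp (- (core_const / 2 * exp (2 * \<eta> * R n)))"
    using p core_mean_ge[OF n(1)] by (intro mult_mono) auto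
  also have "\<dots> = exp (exp (\<eta> * R n) - core_const / 2 * exp (2 * \<eta> * R n))"
    by (simp flip: exp_add)
  also have "\<dots> \<le> error n"
    using n(2) unfolding tails_small_def error_def by (simp only: exp_le_cancel_iff)
  finally show "measure P {\<omega>\<in>space P. card (X \<omega> \<inter> core n) \<le> core_size n} \<le> error n" .
qed

lemma fine_prob:
  assumes "j < fine_count n k"
  shows "fine_box n k j \<in> sets (hrg_intensity n \<alpha> C)"
    "measure P {\<omega>\<in>space P. card (X \<omega> \<inter> fine_box n k j) \<le> 0} \<le> error n"
proof -
  show S: "fine_box n k j \<in> sets (hrg_intensity n \<alpha> C)"
    unfolding fine_box_def
    using order.trans[OF box_radii(1,3)[OF n(1)]] by (intro box_sets n box_radii assms)
  have "measure P {\<omega>\<in>space P. card (X \<omega> \<inter> fine_box n k j) \<le> 0}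
      \<le> 2 ^ 0 * exp (- measure (hrg_intensity n \<alpha> C) (fine_box n k j) / 2)"
    by (rule poisson_process_lower_tail[OF X S])
  also have "\<dots> \<le> exp (- (fine_const / 2) * exp (\<zeta> / 2 * R n))"
    using fine_mean_ge[OF n(1) assms] by simp
  also have "\<dots> \<le> error n"
    using n(2) unfolding tails_small_def error_def by (simp only: exp_le_cancel_iff)
  finally show "measure P {\<omega>\<in>space P. card (X \<omega> \<inter> fine_box n k j) \<le> 0} \<le> error n" .
qed

text \<open>The cell size has twice the exponent of the bound on the mean, so
  \<open>2 ^ cell_size n\<close> dominates; \<open>exp (1 / 2) \<le> 2\<close> brings it to base
  e.\<close>

lemma coarse_prob:
  assumes "i \<in> {1..K}" "j < coarse_count n i"
  shows "coarse_box n i j \<in> sets (hrg_intensity n \<alpha> C)"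
    "measure P {\<omega>\<in>space P. cell_size n \<le> card (X \<omega> \<inter> coarse_box n i j)} \<le> error n"
proof -
  show S: "coarse_box n i j \<in> sets (hrg_intensity n \<alpha> C)"
    unfolding coarse_box_def by (intro box_sets n box_radii assms)
  have "exp (1 / 2) ^ 2 = exp (1 :: real)" by (simp flip: exp_double)
  also have "\<dots> \<le> 2 ^ 2" using e_less_272 by simp
  finally have "exp (1 / 2 :: real) \<le> 2" by (rule power2_le_imp_le) simp
  then have "exp (1 / 2 :: real) ^ cell_size n \<le> 2 ^ cell_size n" by (intro power_mono) auto
  then have "exp (cell_size n * (1 / 2)) \<le> (2 :: real) ^ cell_size n"
    by (simp only: exp_of_nat_mult)
  moreover have "exp (exp (\<kappa> * R n) / 2) \<le> exp (cell_size n * (1 / 2))"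
    by (simp add: cell_size_def of_nat_ceiling)
  ultimately have p: "exp (exp (\<kappa> * R n) / 2) \<le> (2 :: real) ^ cell_size n" by linarith
  have "measure P {\<omega>\<in>space P. cell_size n \<le> card (X \<omega> \<inter> coarse_box n i j)}
      \<le> exp (measure (hrg_intensity n \<alpha> C) (coarse_box n i j)) / 2 ^ cell_size n"
    by (rule poisson_process_upper_tail[OF X S])
  also have "\<dots> \<le> exp (coarse_const * exp (\<kappa> / 2 * R n)) / exp (exp (\<kappa> * R n) / 2)"
    using p coarse_mean_le[OF n(1) assms] by (intro frac_le) auto
  also have "\<dots> = exp (coarse_const * exp (\<kappa> / 2 * R n) - exp (\<kappa> * R n) / 2)"
    by (simp add: exp_diff)
  also have "\<dots> \<le> error n"
    using n(2) unfolding tails_small_def error_def by (simp only: exp_le_cancel_iff)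
  finally show "measure P {\<omega>\<in>space P. cell_size n \<le> card (X \<omega> \<inter> coarse_box n i j)} \<le> error n" .
qed

text \<open>The constant counts the core once and takes 16 and 2 from \<open>counts_le\<close> for
  each of the \<open>L\<close> steps and \<open>K\<close> layers.\<close>

lemma typical_prob:
  "{\<omega>\<in>space P. typical n (X \<omega>)} \<in> sets P"
  "1 - (1 + 16 * L + 2 * K) * exp (R n) * error n \<le> measure P {\<omega>\<in>space P. typical n (X \<omega>)}"
proof -
  interpret prob_space P using X by (simp add: poisson_point_process_def)
  define B1 where "B1 = {\<omega>\<in>space P. card (X \<omega> \<inter> core n) \<le> core_size n}"
  define B2 where "B2 = (\<lambda>k j. {\<omega>\<in>space P. card (X \<omega> \<inter> fine_box n k j) \<le> 0})"
  define B3 where "B3 = (\<lambda>i j. {\<omega>\<in>space P. cell_size n \<le> card (X \<omega> \<inter> coarse_box n i j)})"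
  let ?U2 = "\<Union>k<L. \<Union>j<fine_count n k. B2 k j"
  let ?U3 = "\<Union>i\<in>{1..K}. \<Union>j<coarse_count n i. B3 i j"
  note S = poisson_process_sets[OF X]
  have S1: "B1 \<in> sets P" unfolding B1_def by (intro S core_prob)
  have S2: "B2 k j \<in> sets P" if "j < fine_count n k" for k j
    unfolding B2_def by (intro S fine_prob that)
  have S3: "B3 i j \<in> sets P" if "i \<in> {1..K}" "j < coarse_count n i" for i j
    unfolding B3_def by (intro S coarse_prob that)
  have U2: "?U2 \<in> sets P" using S2 by (intro sets.finite_UN) auto
  have U3: "?U3 \<in> sets P" using S3 by (intro sets.finite_UN) auto
  have eq: "{\<omega>\<in>space P. typical n (X \<omega>)} = space P - (B1 \<union> (?U2 \<union> ?U3))"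
    by (auto simp: typical_def B1_def B2_def B3_def not_le) fastforce+
  show "{\<omega>\<in>space P. typical n (X \<omega>)} \<in> sets P"
    unfolding eq using S1 U2 U3 by auto
  have e: "0 \<le> error n" by (simp add: error_def)
  have "1 \<le> exp (R n)" using largeD(2)[OF n(1)] by simp
  then have "error n * 1 \<le> error n * exp (R n)" using e by (rule mult_left_mono)
  then have p1: "measure P B1 \<le> exp (R n) * error n"
    using core_prob(2) by (simp add: B1_def mult.commute)
  have "measure P ?U2 \<le> (\<Sum>k<L. measure P (\<Union>j<fine_count n k. B2 k j))"
    using S2 by (intro measure_UNION_le) auto
  also have "\<dots> \<le> (\<Sum>k<L. 16 * exp (R n) * error n)"
  proof (rule sum_mono)
    fix k
    have "measure P (\<Union>j<fine_count n k. B2 k j) \<le> (\<Sum>j<fine_count n k. measure P (B2 k j))"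
      using S2 by (intro measure_UNION_le) auto
    also have "\<dots> \<le> (\<Sum>j<fine_count n k. error n)"
      using fine_prob(2) by (intro sum_mono) (auto simp: B2_def)
    also have "\<dots> \<le> 16 * exp (R n) * error n"
      using counts_le(1)[OF n(1), of k] e by (simp add: mult_right_mono)
    finally show "measure P (\<Union>j<fine_count n k. B2 k j) \<le> 16 * exp (R n) * error n" .
  qed
  finally have p2: "measure P ?U2 \<le> L * (16 * exp (R n) * error n)" by simp
  have "measure P ?U3 \<le> (\<Sum>i\<in>{1..K}. measure P (\<Union>j<coarse_count n i. B3 i j))"
    using S3 by (intro measure_UNION_le) auto
  also have "\<dots> \<le> (\<Sum>i\<in>{1..K}. 2 * exp (R n) * error n)"
  proof (rule sum_mono)
    fix i assume i: "i \<in> {1..K}"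
    have "measure P (\<Union>j<coarse_count n i. B3 i j) \<le> (\<Sum>j<coarse_count n i. measure P (B3 i j))"
      using S3[OF i] by (intro measure_UNION_le) auto
    also have "\<dots> \<le> (\<Sum>j<coarse_count n i. error n)"
      using coarse_prob(2)[OF i] by (intro sum_mono) (auto simp: B3_def)
    also have "\<dots> \<le> 2 * exp (R n) * error n"
      using counts_le(2)[OF n(1) i] e by (simp add: mult_right_mono)
    finally show "measure P (\<Union>j<coarse_count n i. B3 i j) \<le> 2 * exp (R n) * error n" .
  qed
  finally have p3: "measure P ?U3 \<le> K * (2 * exp (R n) * error n)" by simp
  have "measure P (B1 \<union> (?U2 \<union> ?U3)) \<le> measure P B1 + (measure P ?U2 + measure P ?U3)"
    using measure_Un_le[OF S1 sets.Un[OF U2 U3]] measure_Un_le[OF U2 U3] by linarith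
  also have "\<dots> \<le> exp (R n) * error n + (L * (16 * exp (R n) * error n) + K * (2 * exp (R n) * error n))"
    using p1 p2 p3 by linarith
  also have "\<dots> = (1 + 16 * L + 2 * K) * exp (R n) * error n" by (simp add: algebra_simps)
  finally show "1 - (1 + 16 * L + 2 * K) * exp (R n) * error n
      \<le> measure P {\<omega>\<in>space P. typical n (X \<omega>)}"
    unfolding eq using S1 U2 U3 by (subst prob_compl) auto
qed

end

lemma wehp_locally_colours:
  assumes X: "\<And>n. poisson_point_process (P n) (hrg_intensity n \<alpha> C) (X n)"
  shows "wehp P (\<lambda>n. {\<omega> \<in> space (P n).
    locally_colours (algorithm n) (2 * L + 2) (n ^ c) (1 + excess n) (X n \<omega>) (hrg_adj n C)})"
proof -
  \<comment> \<open>Chosen so that n^(- f n) = exp (- exp (\<gamma> R) / 2): the other half of the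
    exponent of \<open>error\<close> absorbs the number of boxes. As exp (\<gamma> R) is a power of
    n up to a constant, \<open>f\<close> diverges.\<close>
  define f where "f = (\<lambda>n. exp (\<gamma> * R n) / 2 / ln (real n))"
  define B where "B = real (1 + 16 * L + 2 * K)"
  have \<gamma>: "0 < \<gamma>" by (rule params)
  have "filterlim (\<lambda>n. exp (\<gamma> * (2 * ln (real n) + C)) / 2 / ln (real n)) at_top sequentially"
    using \<gamma> by real_asymp
  then have f: "filterlim f at_top sequentially"
    by (simp add: f_def R_def hrg_radius_def)
  have "\<forall>\<^sub>F x in at_top. ln B + x \<le> exp (\<gamma> * x) / 2"
    using \<gamma> by real_asymp
  then have "\<forall>\<^sub>F n in sequentially. ln B + R n \<le> exp (\<gamma> * R n) / 2"
    using R_at_top by (rule eventually_compose_filterlim)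
  then have "\<forall>\<^sub>F n in sequentially. \<exists>A\<in>sets (P n). A \<subseteq> {\<omega> \<in> space (P n).
        locally_colours (algorithm n) (2 * L + 2) (n ^ c) (1 + excess n) (X n \<omega>) (hrg_adj n C)}
      \<and> 1 - real n powr (- f n) \<le> measure (P n) A"
    using eventually_large eventually_tails_small eventually_ge_at_top[of 2]
  proof eventually_elim
    case (elim n)
    let ?A = "{\<omega>\<in>space (P n). typical n (X n \<omega>)}"
    have "?A \<subseteq> {\<omega> \<in> space (P n).
        locally_colours (algorithm n) (2 * L + 2) (n ^ c) (1 + excess n) (X n \<omega>) (hrg_adj n C)}"
    proof safe
      fix \<omega> assume "\<omega> \<in> space (P n)" "typical n (X n \<omega>)"
      moreover have "space (hrg_intensity n \<alpha> C) = hyp_disk (R n)"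
        by (simp add: hrg_intensity_def space_restrict_space R_def)
      ultimately show "locally_colours (algorithm n) (2 * L + 2) (n ^ c) (1 + excess n) (X n \<omega>) (hrg_adj n C)"
        using X[of n] by (intro locally_colours_typical[OF elim(2)]) (auto simp: poisson_point_process_def)
    qed
    moreover have "1 - real n powr (- f n) \<le> measure (P n) ?A"
    proof -
      have "B * exp (R n) * error n = exp (ln B + R n - exp (\<gamma> * R n))"
      proof -
        have "0 < B" by (simp add: B_def)
        then have "B * exp (R n) * error n = exp (ln B) * exp (R n) * exp (- exp (\<gamma> * R n))"
          by (simp add: error_def)
        also have "\<dots> = exp (ln B + R n - exp (\<gamma> * R n))" by (simp flip: exp_add)
        finally show ?thesis .
      qed
      also have "\<dots> \<le> exp (- (exp (\<gamma> * R n) / 2))" using elim(1) by simp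
      also have "\<dots> = real n powr (- f n)"
        using elim(4) by (simp add: powr_def f_def)
      finally show ?thesis using typical_prob(2)[OF X elim(2,3)] by (simp add: B_def)
    qed
    ultimately show ?case using typical_prob(1)[OF X elim(2,3)] by blast
  qed
  then show ?thesis using f unfolding wehp_def by blast
qed

end

theorem theorem1p4:
  fixes \<alpha> C :: real and c :: nat
  assumes "1 / 2 < \<alpha>" "\<alpha> < 1"
  shows "\<exists>(T :: nat) (A :: nat \<Rightarrow> local_algorithm) (\<epsilon> :: nat \<Rightarrow> real).
    \<epsilon> \<longlonglongrightarrow> 0 \<and>
    (\<forall>(P :: nat \<Rightarrow> 'w measure) (X :: nat \<Rightarrow> 'w \<Rightarrow> (real \<times> real) set).
       (\<forall>n. poisson_point_process (P n) (hrg_intensity n \<alpha> C) (X n)) \<longrightarrow>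
       wehp P (\<lambda>n. {\<omega> \<in> space (P n).
         locally_colours (A n) T (n ^ c) (1 + \<epsilon> n) (X n \<omega>) (hrg_adj n C)}))"
proof -
  interpret hrg_colouring \<alpha> C c
    using assms by unfold_locales
  show ?thesis
    using excess_tendsto wehp_locally_colours by blast
qed

end
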